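(* Consider the following three assertions. (ABC) (Masser–Oesterlé $abc$ Conjecture) For every $\epsilon>0$ there is a constant $\kappa_\epsilon>0$ such that for all coprime positive integers $a,b,c$ with $a+b=c$ we have $c<\kappa_\epsilon\cdot\mathrm{rad}(abc)^{1+\epsilon}$. (SDC) (Small Derivatives Conjecture) There is an absolute constant $0<\eta<1$ such that for all but finitely many triples of coprime positive integers $(a,b,c)$ satisfying $a+b=c$ and not of the form $(1,N,q)$ with $q$ prime (up to order), there is $\psi\in\mathscr{T}(a,b)$ such that $a,b$ are $\psi$-independent and $\|\psi\|<c^\eta$. (O) (Oesterlé's $abc$ Conjecture) There is an absolute constant $M$ such that for all coprime positive integers $a,b,c$ with $a+b=c$ we have $c<\mathrm{rad}(abc)^M$. Then (ABC) implies (SDC), and (SDC) implies (O).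
   Context: For a prime $p$, $v_p$ is the $p$-adic valuation. For a non-zero integer $n$, $\mathrm{supp}(n)$ is the set of primes dividing $n$; for a positive integer $n$, $\mathrm{rad}(n)$ is the product of the distinct primes dividing $n$. Let $\Omega$ be the free $\mathbb{Z}$-module on symbols $\xi_p$, one for each prime $p$. Define $\mathrm{d}:\mathbb{Z}\to\Omega$ by $\mathrm{d}0=0$ and $\mathrm{d}n=\sum_{p\mid n}\frac{n\,v_p(n)}{p}\,\xi_p$ for $n\ne 0$ (the coefficients are integers). For a $\mathbb{Z}$-linear map $\psi:\Omega\to\mathbb{Z}$ put $\|\psi\|=\sup_p|\psi(\xi_p)|$. Let $\mathscr{T}$ be the $\mathbb{Z}$-module of all $\mathbb{Z}$-linear $\psi:\Omega\to\mathbb{Z}$ with $\|\psi\|<\infty$. For $\psi\in\mathscr{T}$ let $\mathrm{d}^\psi=\psi\circ\mathrm{d}:\mathbb{Z}\to\mathbb{Z}$ and $\mathrm{supp}(\psi)=\{p:\psi(\xi_p)\neq0\}$. For positive integers $a,b$, $$\mathscr{T}(a,b)=\{\psi\in\mathscr{T}:\ \mathrm{supp}(\psi)\subseteq\mathrm{supp}(ab(a+b))\ \text{and}\ \mathrm{d}^\psi(a+b)=\mathrm{d}^\psi a+\mathrm{d}^\psi b\}.$$ Integers $a,b$ are $\psi$-independent if $W^\psi(a,b):=a\,\mathrm{d}^\psi b-b\,\mathrm{d}^\psi a\neq 0$. A triple is "of the form $(1,N,q)$ up to order" if some permutation of it equals $(1,N,q)$ with $N$ a positive integer and $q$ prime.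 *)

theory Defs
  imports
    Complex_Main
    "HOL-Computational_Algebra.Computational_Algebra"
    "HOL-Library.Poly_Mapping"
    "HOL-Library.Extended_Real"
begin

(* On type int, the predicate prime holds only for positive primes, so this is the
   usual set of prime numbers. *)
typedef prime_number = "{p :: int. prime p}"
  morphisms prime_val Prime_number
  by (rule exI[of _ 2]) simp

(* The free Z-module on the symbols xi_p: finitely supported integer-valued functions,
   with frag_of p as the basis vector xi_p and frag_cmul as scalar multiplication. *)
type_synonym Omega = "prime_number \<Rightarrow>\<^sub>0 int"

abbreviation xi :: "prime_number \<Rightarrow> Omega" where
  "xi p \<equiv> frag_of p"

lemma module_Omega: "module (frag_cmul :: int \<Rightarrow> Omega \<Rightarrow> Omega)"
  by unfold_locales (simp_all add: frag_cmul_distrib frag_cmul_distrib2)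

lemma module_int: "module ((*) :: int \<Rightarrow> int \<Rightarrow> int)"
  by unfold_locales (simp_all add: algebra_simps)

definition supp :: "int \<Rightarrow> prime_number set" where
  "supp n = {p. prime_val p dvd n}"

definition rad :: "int \<Rightarrow> int" where
  "rad n = \<Prod>(prime_factors n)"

(* The integer division is exact: if p divides n, then p divides n * v_p(n). *)
definition d :: "int \<Rightarrow> Omega" where
  "d n = (if n = 0 then 0
          else \<Sum>p\<in>supp n. frag_cmul ((n * int (multiplicity (prime_val p) n)) div prime_val p) (xi p))"

(* Taken in the extended reals, so that the supremum of an unbounded family is infinite. *)
definition psi_norm :: "(Omega \<Rightarrow> int) \<Rightarrow> ereal" where
  "psi_norm \<psi> = (SUP p. ereal (real_of_int \<bar>\<psi> (xi p)\<bar>))"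

definition bounded_maps :: "(Omega \<Rightarrow> int) set" where
  "bounded_maps = {\<psi>. module_hom frag_cmul (*) \<psi> \<and> psi_norm \<psi> < \<infinity>}"

definition d_psi :: "(Omega \<Rightarrow> int) \<Rightarrow> int \<Rightarrow> int" where
  "d_psi \<psi> = \<psi> \<circ> d"

definition psi_supp :: "(Omega \<Rightarrow> int) \<Rightarrow> prime_number set" where
  "psi_supp \<psi> = {p. \<psi> (xi p) \<noteq> 0}"

definition derivations :: "int \<Rightarrow> int \<Rightarrow> (Omega \<Rightarrow> int) set" where
  "derivations a b =
     {\<psi> \<in> bounded_maps. psi_supp \<psi> \<subseteq> supp (a * b * (a + b)) \<and>
        d_psi \<psi> (a + b) = d_psi \<psi> a + d_psi \<psi> b}"

definition W :: "(Omega \<Rightarrow> int) \<Rightarrow> int \<Rightarrow> int \<Rightarrow> int" where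
  "W \<psi> a b = a * d_psi \<psi> b - b * d_psi \<psi> a"

definition psi_independent :: "(Omega \<Rightarrow> int) \<Rightarrow> int \<Rightarrow> int \<Rightarrow> bool" where
  "psi_independent \<psi> a b \<longleftrightarrow> W \<psi> a b \<noteq> 0"

(* Because a + b = c, gcd(a,b,c) = 1 is the same as pairwise coprimality. *)
definition abc_triple :: "int \<Rightarrow> int \<Rightarrow> int \<Rightarrow> bool" where
  "abc_triple a b c \<longleftrightarrow> a > 0 \<and> b > 0 \<and> c > 0 \<and> Gcd {a, b, c} = 1 \<and> a + b = c"

(* Equality of multisets expresses equality up to order. *)
definition one_N_prime_form :: "int \<Rightarrow> int \<Rightarrow> int \<Rightarrow> bool" where
  "one_N_prime_form a b c \<longleftrightarrow> (\<exists>N q. N > 0 \<and> prime q \<and> {#a, b, c#} = {#1, N, q#})"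

definition ABC_conjecture :: bool where
  "ABC_conjecture \<longleftrightarrow>
     (\<forall>\<epsilon>::real. \<epsilon> > 0 \<longrightarrow> (\<exists>\<kappa>::real. \<kappa> > 0 \<and>
        (\<forall>a b c. abc_triple a b c \<longrightarrow>
           real_of_int c < \<kappa> * real_of_int (rad (a * b * c)) powr (1 + \<epsilon>))))"

definition small_derivatives_conjecture :: bool where
  "small_derivatives_conjecture \<longleftrightarrow>
     (\<exists>\<eta>::real. 0 < \<eta> \<and> \<eta> < 1 \<and>
        finite {(a, b, c). abc_triple a b c \<and> \<not> one_N_prime_form a b c \<and>
          \<not> (\<exists>\<psi>\<in>derivations a b. psi_independent \<psi> a b \<and>
                psi_norm \<psi> < ereal (real_of_int c powr \<eta>))})"

definition Oesterle_conjecture :: bool where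
  "Oesterle_conjecture \<longleftrightarrow>
     (\<exists>M::real. \<forall>a b c. abc_triple a b c \<longrightarrow>
        real_of_int c < real_of_int (rad (a * b * c)) powr M)"

end

theory Submission
  imports Defs "HOL-Real_Asymp.Real_Asymp"
begin

text \<open>
  Write \<open>t p\<close> for \<open>\<psi> (xi p)\<close> and \<open>L n\<close> for the logarithmic derivative
  \<open>\<Sum>p. v_p(n) t(p) / p\<close>, so that \<open>d\<psi> n = n L n\<close> and \<open>W = a b (L b - L a)\<close>.

  (SDC) implies (O): the numbers \<open>rad n * L n\<close> are integers, and the relation
  \<open>a L a + b L b = c L c\<close> forces \<open>L b - L a\<close> to be an integral multiple of \<open>c / rad (a b c)\<close>.
  If it is non-zero, then \<open>c / rad (a b c)\<close> is at most the norm of \<open>\<psi>\<close> times \<open>2 log c\<close>.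

  (ABC) implies (SDC), with exponent 9/10. Suppose first that some prime \<open>p > c^(2/3)\<close> divides
  \<open>a b c\<close>. Since the triple is not of the form \<open>(1, N, q)\<close>, there are two further primes such that
  the pigeonhole principle yields a non-zero solution \<open>t\<close> supported on the three primes with entries
  of size about \<open>sqrt (c log c) < p\<close>; a solution with \<open>W = 0\<close> would have \<open>p\<close> dividing \<open>t p\<close>, hence
  vanish. If all primes dividing \<open>a b c\<close> are at most \<open>c^(2/3)\<close>, choose rational values of
  \<open>L\<close> with denominators \<open>rad a\<close>, \<open>rad b\<close>, \<open>rad c\<close> and \<open>L b - L a = c / rad (a b c)\<close>, which
  is at most \<open>c^(1/10)\<close> up to a constant by (ABC), and realise them by partial fractions. The factor
  \<open>v_p(n)\<close> is absorbed by scaling with the product of all these valuations, which is \<open>O(c^(1/10))\<close>.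
\<close>

section \<open>Logarithmic derivatives and radicals\<close>

text \<open>Real-valued for comparison with logarithms; \<open>t\<close> is a function of integers,
  so that sums run over \<open>prime_factors\<close> instead of the subtype of primes.\<close>

definition log_deriv :: "(int \<Rightarrow> int) \<Rightarrow> int \<Rightarrow> real" where
  "log_deriv t n =
     (\<Sum>p\<in>prime_factors n. real (multiplicity p n) * real_of_int (t p) / real_of_int p)"

lemma bij_betw_prime_val_supp:
  assumes "n \<noteq> 0"
  shows "bij_betw prime_val (supp n) (prime_factors n)"
proof (rule bij_betw_imageI)
  show "inj_on prime_val (supp n)"
    by (simp add: inj_on_def prime_val_inject)
  show "prime_val ` supp n = prime_factors n"
  proof (intro equalityI subsetI)
    fix p assume "p \<in> prime_val ` supp n"
    then show "p \<in> prime_factors n"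
      using assms prime_val by (auto simp: supp_def in_prime_factors_iff)
  next
    fix p assume "p \<in> prime_factors n"
    then have "prime p" "p dvd n" by (auto simp: in_prime_factors_iff)
    then show "p \<in> prime_val ` supp n"
      by (intro image_eqI[of _ _ "Prime_number p"])
         (auto simp: supp_def Prime_number_inverse)
  qed
qed

lemma dvd_mult_multiplicity:
  fixes p n :: int
  shows "p dvd n * int (multiplicity p n)"
  by (cases "p dvd n") (auto simp: not_dvd_imp_multiplicity_0)

text \<open>Links the given definitions to \<open>log_deriv\<close>: linearity takes
  \<open>\<psi>\<close> inside the sum, and exact divisibility turns each integer quotient into a
  real one.\<close>

lemma d_psi_eq_log_deriv:
  assumes "module_hom frag_cmul (*) \<psi>" "n \<noteq> 0"
  shows "real_of_int (d_psi \<psi> n) =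
         real_of_int n * log_deriv (\<lambda>p. \<psi> (xi (Prime_number p))) n"
proof -
  interpret module_hom frag_cmul "(*)" \<psi> by fact
  let ?c = "\<lambda>p. (n * int (multiplicity p n)) div p"
  have "d_psi \<psi> n = (\<Sum>p\<in>supp n. ?c (prime_val p) * \<psi> (xi p))"
    using assms(2) by (simp add: d_psi_def d_def sum scale)
  also have "\<dots> = (\<Sum>p\<in>supp n. ?c (prime_val p) * \<psi> (xi (Prime_number (prime_val p))))"
    by (simp add: prime_val_inverse)
  also have "\<dots> = (\<Sum>p\<in>prime_factors n. ?c p * \<psi> (xi (Prime_number p)))"
    by (rule sum.reindex_bij_betw[OF bij_betw_prime_val_supp[OF assms(2)]])
  finally have "real_of_int (d_psi \<psi> n) =
      (\<Sum>p\<in>prime_factors n. real_of_int (?c p) * real_of_int (\<psi> (xi (Prime_number p))))"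
    by simp
  also have "\<dots> = (\<Sum>p\<in>prime_factors n. real_of_int n *
      (real (multiplicity p n) * real_of_int (\<psi> (xi (Prime_number p))) / real_of_int p))"
    by (intro sum.cong refl)
       (simp add: real_of_int_div dvd_mult_multiplicity field_simps)
  finally show ?thesis
    by (simp add: log_deriv_def sum_distrib_left)
qed

lemma log_deriv_minus [simp]: "log_deriv t (- n) = log_deriv t n"
proof -
  have "multiplicity p (- n) = multiplicity p n" for p
    by (metis multiplicity_normalize_right normalize_int_def abs_minus_cancel)
  then show ?thesis by (simp add: log_deriv_def)
qed

lemma log_deriv_1 [simp]: "log_deriv t 1 = 0"
  by (simp add: log_deriv_def)

section \<open>Logarithmic bounds for prime factors and valuations\<close>

text \<open>Replacing every prime of the factorization by 2 can only decrease the product. The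
  logarithmic bounds that follow all come from this.\<close>

lemma two_power_sum_multiplicity_le:
  fixes n :: int
  assumes "n \<noteq> 0"
  shows "2 ^ (\<Sum>p\<in>prime_factors n. multiplicity p n) \<le> \<bar>n\<bar>"
proof -
  have "(2::int) ^ (\<Sum>p\<in>prime_factors n. multiplicity p n) =
        (\<Prod>p\<in>prime_factors n. 2 ^ multiplicity p n)"
    by (rule power_sum)
  also have "\<dots> \<le> (\<Prod>p\<in>prime_factors n. p ^ multiplicity p n)"
    by (intro prod_mono conjI power_mono)
       (auto simp: in_prime_factors_iff dest: prime_ge_2_int)
  also have "\<dots> = \<bar>n\<bar>"
    using assms by (simp add: prod_prime_factors)
  finally show ?thesis .
qed

lemma sum_multiplicity_le_log:
  fixes n :: int and x :: real
  assumes "n \<noteq> 0" "real_of_int \<bar>n\<bar> \<le> x"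
  shows "real (\<Sum>p\<in>prime_factors n. multiplicity p n) \<le> log 2 x"
proof -
  have "(2::real) ^ (\<Sum>p\<in>prime_factors n. multiplicity p n) \<le> real_of_int \<bar>n\<bar>"
    using two_power_sum_multiplicity_le[OF assms(1)]
    by (metis of_int_le_iff of_int_numeral of_int_power)
  then have "(2::real) ^ (\<Sum>p\<in>prime_factors n. multiplicity p n) \<le> x"
    using assms(2) by linarith
  moreover have "x > 0" using assms by linarith
  ultimately show ?thesis
    by (metis le_log_of_power one_less_numeral_iff semiring_norm(76))
qed

lemma card_prime_factors_le_log:
  fixes n :: int and x :: real
  assumes "n \<noteq> 0" "real_of_int \<bar>n\<bar> \<le> x"
  shows "real (card (prime_factors n)) \<le> log 2 x"
proof -
  have "card (prime_factors n) = (\<Sum>p\<in>prime_factors n. 1)" by simp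
  also have "\<dots> \<le> (\<Sum>p\<in>prime_factors n. multiplicity p n)"
    by (intro sum_mono) (simp add: prime_factors_multiplicity)
  finally show ?thesis
    using sum_multiplicity_le_log[OF assms] by linarith
qed

lemma multiplicity_le_log:
  fixes n p :: int and x :: real
  assumes "n \<noteq> 0" "real_of_int \<bar>n\<bar> \<le> x" "prime p"
  shows "real (multiplicity p n) \<le> log 2 x"
proof (cases "p \<in> prime_factors n")
  case True
  then have "multiplicity p n \<le> (\<Sum>p\<in>prime_factors n. multiplicity p n)"
    by (intro member_le_sum) auto
  then show ?thesis
    using sum_multiplicity_le_log[OF assms(1,2)] by linarith
next
  case False
  then have "multiplicity p n = 0"
    using assms by (simp add: prime_factors_multiplicity)
  moreover have "x \<ge> 1" using assms by linarith
  ultimately show ?thesis by simp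
qed

text \<open>Each factor \<open>1 / p\<close> is estimated by 1, which leaves \<open>B\<close> times
  the number of prime factors counted with multiplicity.\<close>

lemma abs_log_deriv_le:
  assumes "n \<noteq> 0" "real_of_int \<bar>n\<bar> \<le> x" "\<And>p. real_of_int \<bar>t p\<bar> \<le> B"
  shows "\<bar>log_deriv t n\<bar> \<le> B * log 2 x"
proof -
  have B: "B \<ge> 0" using assms(3)[of 0] by linarith
  have "\<bar>log_deriv t n\<bar> \<le> (\<Sum>p\<in>prime_factors n. B * real (multiplicity p n))"
    unfolding log_deriv_def
  proof (rule order_trans[OF sum_abs sum_mono])
    fix p assume "p \<in> prime_factors n"
    then have p: "p \<ge> 1" by (auto simp: in_prime_factors_iff dest: prime_ge_1_int)
    have "\<bar>real (multiplicity p n) * real_of_int (t p) / real_of_int p\<bar> =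
        real (multiplicity p n) * \<bar>real_of_int (t p)\<bar> / real_of_int p"
      using p by (simp add: abs_mult)
    also have "\<dots> \<le> real (multiplicity p n) * \<bar>real_of_int (t p)\<bar> / 1"
      using p by (intro divide_left_mono) auto
    also have "\<dots> \<le> real (multiplicity p n) * B"
      using assms(3)[of p] by (auto intro!: mult_left_mono)
    finally show "\<bar>real (multiplicity p n) * real_of_int (t p) / real_of_int p\<bar> \<le>
        B * real (multiplicity p n)" by (simp add: mult.commute)
  qed
  also have "\<dots> = B * real (\<Sum>p\<in>prime_factors n. multiplicity p n)"
    by (simp add: sum_distrib_left)
  also have "\<dots> \<le> B * log 2 x"
    using sum_multiplicity_le_log[OF assms(1,2)] B by (rule mult_left_mono)
  finally show ?thesis .
qed

section \<open>Radicals as common denominators\<close>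

lemma rad_pos [simp]: "rad n > 0"
  unfolding rad_def
  by (intro prod_pos) (auto simp: in_prime_factors_iff dest: prime_gt_0_int)

lemma rad_dvd: "n \<noteq> 0 \<Longrightarrow> rad n dvd n"
proof -
  assume n: "n \<noteq> 0"
  have "\<Prod>(prime_factors n) dvd (\<Prod>p\<in>prime_factors n. p ^ multiplicity p n)"
    by (intro prod_dvd_prod) (auto simp: prime_factors_multiplicity)
  then show ?thesis
    using n by (simp add: prod_prime_factors rad_def)
qed

lemma prime_factors_Int_coprime:
  fixes a b :: int
  assumes "coprime a b"
  shows "prime_factors a \<inter> prime_factors b = {}"
  using assms by (auto simp: in_prime_factors_iff dest: coprime_common_divisor not_prime_unit)

lemma rad_mult_coprime:
  assumes "a \<noteq> 0" "b \<noteq> 0" "coprime a b"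
  shows "rad (a * b) = rad a * rad b"
  using assms by (simp add: rad_def prime_factors_product prod.union_disjoint prime_factors_Int_coprime)

lemma coprime_rad:
  assumes "a \<noteq> 0" "b \<noteq> 0" "coprime a b"
  shows "coprime (rad a) (rad b)"
  using assms by (meson coprime_divisors rad_dvd)

lemma prime_le_rad:
  assumes "prime q" "q dvd n" "n \<noteq> 0"
  shows "q \<le> rad n"
proof -
  have "q \<in> prime_factors n"
    using assms by (simp add: in_prime_factors_iff)
  then have "q dvd rad n"
    unfolding rad_def by (intro dvd_prodI) auto
  then show ?thesis by (rule zdvd_imp_le) simp
qed

text \<open>Every prime factor of \<open>n\<close> divides \<open>rad n\<close>, which is therefore
  a common denominator of the terms of \<open>log_deriv t n\<close>.\<close>

lemma rad_mult_log_deriv_Ints: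
  "\<exists>X. real_of_int (rad n) * log_deriv t n = real_of_int X"
proof -
  have "real_of_int (rad n) * log_deriv t n \<in> \<int>"
    unfolding log_deriv_def sum_distrib_left
  proof (rule Ints_sum)
    fix p assume p: "p \<in> prime_factors n"
    then have "p dvd rad n"
      unfolding rad_def by (intro dvd_prodI) auto
    then obtain k where k: "rad n = p * k" by blast
    have "p > 0" using p by (auto simp: in_prime_factors_iff dest: prime_gt_0_int)
    then have "real_of_int (rad n) *
        (real (multiplicity p n) * real_of_int (t p) / real_of_int p) =
        real_of_int (k * int (multiplicity p n) * t p)"
      by (simp add: k)
    then show "real_of_int (rad n) *
        (real (multiplicity p n) * real_of_int (t p) / real_of_int p) \<in> \<int>"
      by (metis Ints_of_int)
  qed
  then show ?thesis by (auto elim: Ints_cases)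
qed

lemma abc_tripleD:
  assumes "abc_triple a b c"
  shows "a > 0" "b > 0" "c > 0" "c = a + b" "coprime a b" "coprime a c" "coprime b c"
proof -
  show *: "a > 0" "b > 0" "c > 0" "c = a + b"
    using assms by (auto simp: abc_triple_def)
  have "is_unit k" if "k dvd a" "k dvd b" for k
  proof -
    have "k dvd Gcd {a, b, c}"
      using that * by (intro Gcd_greatest) auto
    also have "Gcd {a, b, c} = 1"
      using assms by (simp only: abc_triple_def)
    finally show ?thesis .
  qed
  then show ab: "coprime a b" by (rule coprimeI)
  show "coprime a c"
    using ab * by (simp add: coprime_iff_gcd_eq_1)
  show "coprime b c"
    using ab * by (metis add.commute coprime_commute coprime_iff_gcd_eq_1 gcd_add2)
qed

lemma rad_abc:
  assumes "abc_triple a b c"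
  shows "rad (a * b * c) = rad a * rad b * rad c"
proof -
  note * = abc_tripleD[OF assms]
  have "coprime (a * b) c" using * by simp
  then show ?thesis using * by (simp add: rad_mult_coprime)
qed

text \<open>Clearing denominators turns \<open>L b - L a\<close> into an integer \<open>Y\<close>,
  which the relation makes divisible by \<open>c / rad c\<close>; a nonzero multiple is at least as
  large in absolute value.\<close>

lemma c_div_rad_le_log_deriv_diff:
  assumes "abc_triple a b c"
    and eq: "real_of_int c * log_deriv t c = real_of_int a * log_deriv t a + real_of_int b * log_deriv t b"
    and ne: "log_deriv t a \<noteq> log_deriv t b"
  shows "real_of_int c / real_of_int (rad (a * b * c)) \<le> \<bar>log_deriv t b - log_deriv t a\<bar>"
proof -
  note * = abc_tripleD[OF assms(1)]
  obtain Xa Xb Xc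
    where X: "real_of_int (rad a) * log_deriv t a = real_of_int Xa"
             "real_of_int (rad b) * log_deriv t b = real_of_int Xb"
             "real_of_int (rad c) * log_deriv t c = real_of_int Xc"
    using rad_mult_log_deriv_Ints by metis
  obtain a' b' c' where abc': "a = rad a * a'" "b = rad b * b'" "c = rad c * c'"
    using rad_dvd * by (metis dvdE less_irrefl)
  \<comment> \<open>This is \<open>rad a * rad b\<close> times the difference
    \<open>log_deriv t b - log_deriv t a\<close>.\<close>
  define Y where "Y = rad a * Xb - rad b * Xa"
  have "real_of_int (c' * Xc) = real_of_int (a' * Xa + b' * Xb)"
  proof -
    have "real_of_int (c' * Xc) = real_of_int (rad c * c') * log_deriv t c"
         "real_of_int (a' * Xa) = real_of_int (rad a * a') * log_deriv t a"
         "real_of_int (b' * Xb) = real_of_int (rad b * b') * log_deriv t b"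
      using X by simp_all
    then show ?thesis
      using eq abc' by simp
  qed
  then have lin: "c' * Xc = a' * Xa + b' * Xb" by linarith
  \<comment> \<open>Eliminating \<open>b' * Xb\<close> by \<open>lin\<close> leaves
    \<open>Xa\<close> with coefficient \<open>-(a + b) = - c\<close>, a multiple of
    \<open>c'\<close>.\<close>
  have "b' * Y = rad a * (b' * Xb) - Xa * (rad b * b')"
    by (simp add: Y_def algebra_simps)
  also have "\<dots> = rad a * (c' * Xc) - Xa * (rad a * a' + rad b * b')"
    using lin by (simp add: algebra_simps)
  also have "rad a * a' + rad b * b' = rad c * c'"
    using abc' * by metis
  also have "rad a * (c' * Xc) - Xa * (rad c * c') = c' * (rad a * Xc - rad c * Xa)"
    by (simp add: algebra_simps)
  finally have "c' dvd b' * Y" by simp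
  moreover have "coprime c' b'"
    using *(7) abc' by (metis coprime_commute coprime_mult_left_iff coprime_mult_right_iff)
  ultimately have "c' dvd Y" by (simp add: coprime_dvd_mult_right_iff)
  have Y: "real_of_int Y = real_of_int (rad a * rad b) * (log_deriv t b - log_deriv t a)"
    using X by (simp add: Y_def algebra_simps)
  have "Y \<noteq> 0"
    using Y ne by (metis eq_iff_diff_eq_0 less_irrefl mult_eq_0_iff of_int_0 of_int_eq_0_iff rad_pos)
  have "c' > 0" using abc'(3) * by (metis rad_pos zero_less_mult_pos)
  have "c' \<le> \<bar>Y\<bar>"
    using \<open>c' dvd Y\<close> \<open>Y \<noteq> 0\<close> by (simp add: dvd_imp_le_int zdvd_imp_le)
  then have "real_of_int c' \<le> real_of_int (rad a * rad b) * \<bar>log_deriv t b - log_deriv t a\<bar>"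
    using Y by (metis abs_mult abs_of_pos mult_pos_pos of_int_0_less_iff of_int_abs of_int_le_iff rad_pos)
  moreover have "real_of_int c / real_of_int (rad (a * b * c)) =
      real_of_int c' / real_of_int (rad a * rad b)"
  proof -
    have "rad c \<noteq> 0" using rad_pos[of c] by linarith
    then show ?thesis
      unfolding rad_abc[OF assms(1)] by (subst abc'(3)) simp
  qed
  ultimately show ?thesis
    by (simp add: divide_le_eq mult.commute)
qed

text \<open>
  Symmetric in the three arguments; it is applied to \<open>(a, b, - c)\<close>. Given the linear relation, all
  three logarithmic derivatives agree as soon as two of them do, so the last clause is
  \<open>\<psi>\<close>-independence.
\<close>
definition small_solution :: "real \<Rightarrow> int \<Rightarrow> int \<Rightarrow> int \<Rightarrow> bool" where
  "small_solution H x y z \<longleftrightarrow>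
     (\<exists>t. (\<forall>p. real_of_int \<bar>t p\<bar> \<le> H) \<and> (\<forall>p. t p \<noteq> 0 \<longrightarrow> p dvd x * y * z) \<and>
          real_of_int x * log_deriv t x + real_of_int y * log_deriv t y +
            real_of_int z * log_deriv t z = 0 \<and>
          \<not> (log_deriv t x = log_deriv t y \<and> log_deriv t y = log_deriv t z))"

lemma small_solution_swap12: "small_solution H x y z \<longleftrightarrow> small_solution H y x z"
  unfolding small_solution_def by (auto simp: ac_simps intro!: ex_cong)

lemma small_solution_swap23: "small_solution H x y z \<longleftrightarrow> small_solution H x z y"
  unfolding small_solution_def by (auto simp: ac_simps intro!: ex_cong)

section \<open>From functions on primes to derivations\<close>

text \<open>\<open>frag_extend\<close> maps into a free abelian group, so the integers are
  represented as the free group on the single generator \<open>()\<close> and the coefficient there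
  is read off.\<close>

definition map_of_values :: "(int \<Rightarrow> int) \<Rightarrow> Omega \<Rightarrow> int" where
  "map_of_values t \<omega> =
     Poly_Mapping.lookup (frag_extend (\<lambda>p. frag_cmul (t (prime_val p)) (frag_of ())) \<omega>) ()"

lemma map_of_values_xi [simp]: "map_of_values t (xi p) = t (prime_val p)"
  by (simp add: map_of_values_def)

lemma module_hom_map_of_values: "module_hom frag_cmul (*) (map_of_values t)"
proof -
  interpret module_pair "frag_cmul :: int \<Rightarrow> Omega \<Rightarrow> Omega" "(*) :: int \<Rightarrow> int \<Rightarrow> int"
    by (intro module_pair.intro module_Omega module_int)
  show ?thesis
    by unfold_locales
       (simp_all add: map_of_values_def frag_extend_add frag_extend_cmul lookup_add)
qed

text \<open>The linear relation is additivity of \<open>d_psi\<close> at \<open>a\<close> and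
  \<open>b\<close>, and the identity \<open>W = a b (L b - L a)\<close> gives independence.\<close>

lemma derivation_of_small_solution:
  assumes abc: "abc_triple a b c" and small: "small_solution H a b (- c)"
  shows "\<exists>\<psi>\<in>derivations a b. psi_independent \<psi> a b \<and> psi_norm \<psi> \<le> ereal H"
proof -
  note * = abc_tripleD[OF abc]
  from small obtain t where
    bound: "\<And>p. real_of_int \<bar>t p\<bar> \<le> H" and
    supp: "\<And>p. t p \<noteq> 0 \<Longrightarrow> p dvd a * b * c" and
    eq: "real_of_int a * log_deriv t a + real_of_int b * log_deriv t b = real_of_int c * log_deriv t c" and
    ne: "\<not> (log_deriv t a = log_deriv t b \<and> log_deriv t b = log_deriv t c)"
    unfolding small_solution_def by auto
  let ?\<psi> = "map_of_values t"
  have d: "real_of_int (d_psi ?\<psi> n) = real_of_int n * log_deriv t n" if "n \<noteq> 0" for n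
  proof -
    have "log_deriv (\<lambda>p. ?\<psi> (xi (Prime_number p))) n = log_deriv t n"
      unfolding log_deriv_def
      by (intro sum.cong refl) (auto simp: Prime_number_inverse in_prime_factors_iff)
    then show ?thesis
      using d_psi_eq_log_deriv[OF module_hom_map_of_values that] by simp
  qed
  have norm: "psi_norm ?\<psi> \<le> ereal H"
    unfolding psi_norm_def by (intro SUP_least) (use bound in auto)
  have "real_of_int (d_psi ?\<psi> (a + b)) = real_of_int (d_psi ?\<psi> a + d_psi ?\<psi> b)"
    using d[of a] d[of b] d[of c] eq * by simp
  then have "d_psi ?\<psi> (a + b) = d_psi ?\<psi> a + d_psi ?\<psi> b" by linarith
  moreover have "psi_supp ?\<psi> \<subseteq> Defs.supp (a * b * (a + b))"
    using supp * by (auto simp: psi_supp_def supp_def)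
  moreover have "psi_norm ?\<psi> < \<infinity>"
    using norm by (rule order_le_less_trans) simp
  ultimately have "?\<psi> \<in> derivations a b"
    using module_hom_map_of_values by (simp add: derivations_def bounded_maps_def)
  moreover have "psi_independent ?\<psi> a b"
  proof -
    have "log_deriv t a \<noteq> log_deriv t b"
    proof
      \<comment> \<open>If \<open>L a = L b\<close>, then \<open>a + b = c\<close> turns the
        relation into \<open>c L b = c L c\<close>, so all three would agree.\<close>
      assume eq': "log_deriv t a = log_deriv t b"
      then have "real_of_int c * log_deriv t b = real_of_int c * log_deriv t c"
        using eq *(4) by (simp add: distrib_right)
      then show False using ne eq' * by simp
    qed
    moreover have "real_of_int (W ?\<psi> a b) =
        real_of_int (a * b) * (log_deriv t b - log_deriv t a)"
      using d[of a] d[of b] * by (simp add: W_def algebra_simps)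
    ultimately have "real_of_int (W ?\<psi> a b) \<noteq> 0"
      using * by simp
    then show ?thesis
      unfolding psi_independent_def by linarith
  qed
  ultimately show ?thesis using norm by blast
qed

section \<open>Small derivatives bound the radical\<close>

text \<open>Since \<open>c = a + b\<close> is at least 2, it has a prime factor. The bound makes
  powers of the radical increase with the exponent.\<close>

lemma two_le_rad:
  assumes "abc_triple a b c"
  shows "rad (a * b * c) \<ge> 2"
proof -
  note * = abc_tripleD[OF assms]
  then have "\<not> is_unit c" by simp
  then obtain p where "prime p" "p dvd c"
    using * prime_divisor_exists[of c] by auto
  then have "p \<le> rad (a * b * c)"
    using * by (intro prime_le_rad) auto
  then show ?thesis
    using prime_ge_2_int[OF \<open>prime p\<close>] by linarith
qed

text \<open>Treats the triples exempted from SDC: comparing sums of entries gives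
  \<open>c \<le> q + 1 < 2 * q\<close>, while both 2 and \<open>q\<close> are at most the
  radical.\<close>

lemma one_N_prime_form_less:
  assumes "abc_triple a b c" "one_N_prime_form a b c"
  shows "c < rad (a * b * c) ^ 2"
proof -
  note * = abc_tripleD[OF assms(1)]
  from assms(2) obtain N q where q: "prime q" and ms: "{#a, b, c#} = {#1, N, q#}"
    unfolding one_N_prime_form_def by blast
  have "sum_mset {#a, b, c#} = sum_mset {#1, N, q#}" using ms by simp
  then have sum: "2 * c = 1 + N + q" using *(4) by simp
  have "c \<in> set_mset {#1, N, q#}" by (subst ms[symmetric]) simp
  then have "c = 1 \<or> c = N \<or> c = q" by simp
  then have c: "c \<le> q + 1" using sum * by linarith
  have "q \<in> set_mset {#a, b, c#}" by (subst ms) simp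
  then have "q \<le> rad (a * b * c)"
    using q * by (intro prime_le_rad) auto
  moreover have "2 \<le> q" by (rule prime_ge_2_int[OF q])
  ultimately have "2 * q \<le> rad (a * b * c) ^ 2"
    unfolding power2_eq_square by (intro mult_mono) auto
  then show ?thesis using c \<open>2 \<le> q\<close> by linarith
qed

text \<open>The integrality bound from below meets the upper estimate \<open>B * log 2 c\<close> for
  each of the two logarithmic derivatives.\<close>

lemma c_le_rad_of_derivation:
  assumes abc: "abc_triple a b c" and \<psi>: "\<psi> \<in> derivations a b" "psi_independent \<psi> a b"
    and norm: "psi_norm \<psi> \<le> ereal B"
  shows "real_of_int c \<le> 2 * B * log 2 (real_of_int c) * real_of_int (rad (a * b * c))"
proof -
  note * = abc_tripleD[OF abc]
  define t where "t = (\<lambda>p. \<psi> (xi (Prime_number p)))"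
  have hom: "module_hom frag_cmul (*) \<psi>"
    and add: "d_psi \<psi> (a + b) = d_psi \<psi> a + d_psi \<psi> b"
    using \<psi> by (auto simp: derivations_def bounded_maps_def)
  have d: "real_of_int (d_psi \<psi> n) = real_of_int n * log_deriv t n" if "n \<noteq> 0" for n
    unfolding t_def by (rule d_psi_eq_log_deriv[OF hom that])
  have bound: "real_of_int \<bar>t p\<bar> \<le> B" for p
  proof -
    have "ereal (real_of_int \<bar>t p\<bar>) \<le> psi_norm \<psi>"
      unfolding psi_norm_def t_def by (rule SUP_upper) simp
    then show ?thesis using norm order_trans ereal_less_eq(3) by blast
  qed
  have eq: "real_of_int c * log_deriv t c = real_of_int a * log_deriv t a + real_of_int b * log_deriv t b"
    using d[of a] d[of b] d[of c] arg_cong[OF add, of real_of_int] * by simp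
  have "real_of_int (W \<psi> a b) \<noteq> 0"
    using \<psi>(2) by (simp add: psi_independent_def)
  moreover have "real_of_int (W \<psi> a b) =
      real_of_int (a * b) * (log_deriv t b - log_deriv t a)"
    using d[of a] d[of b] * by (simp add: W_def algebra_simps)
  ultimately have "log_deriv t a \<noteq> log_deriv t b" by auto
  from c_div_rad_le_log_deriv_diff[OF abc eq this]
  have "real_of_int c / real_of_int (rad (a * b * c)) \<le> \<bar>log_deriv t b - log_deriv t a\<bar>" .
  moreover have "\<bar>log_deriv t a\<bar> \<le> B * log 2 (real_of_int c)"
    using * bound by (intro abs_log_deriv_le) auto
  moreover have "\<bar>log_deriv t b\<bar> \<le> B * log 2 (real_of_int c)"
    using * bound by (intro abs_log_deriv_le) auto
  ultimately have "real_of_int c / real_of_int (rad (a * b * c)) \<le> 2 * B * log 2 (real_of_int c)"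
    by linarith
  then show ?thesis by (simp add: divide_le_eq)
qed

text \<open>The exponent \<open>M\<close> is a maximum over three cases: triples of the exempt form,
  bounded \<open>c\<close> (including the finitely many exceptions), and triples with a small
  derivation.\<close>

lemma small_derivatives_imp_Oesterle:
  assumes small_derivatives_conjecture
  shows Oesterle_conjecture
proof -
  let ?bad = "\<lambda>\<eta>. {(a, b, c). abc_triple a b c \<and> \<not> one_N_prime_form a b c \<and>
          \<not> (\<exists>\<psi>\<in>derivations a b. psi_independent \<psi> a b \<and>
                psi_norm \<psi> < ereal (real_of_int c powr \<eta>))}"
  obtain \<eta> :: real where \<eta>: "0 < \<eta>" "\<eta> < 1" and fin: "finite (?bad \<eta>)"
    using assms unfolding small_derivatives_conjecture_def by blast
  \<comment> \<open>Since \<open>\<eta> + 2 * \<delta> = 1\<close>, one \<open>\<delta>\<close>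
    absorbs the factor \<open>2 * log 2 c\<close> and the other survives in
    \<open>c powr \<delta> < rad (a * b * c)\<close>.\<close>
  define \<delta> where "\<delta> = (1 - \<eta>) / 2"
  have \<delta>: "\<delta> > 0" using \<eta> by (simp add: \<delta>_def)
  have "eventually (\<lambda>x::real. 2 * log 2 x < x powr \<delta>) at_top"
    using \<delta> by real_asymp
  then obtain x0 where x0: "\<And>x. x \<ge> x0 \<Longrightarrow> 2 * log 2 x < x powr \<delta>"
    unfolding eventually_at_top_linorder by blast
  have "finite ((\<lambda>(a, b, c). c) ` ?bad \<eta>)" using fin by (rule finite_imageI)
  then obtain c1 where c1: "\<And>a b c. (a, b, c) \<in> ?bad \<eta> \<Longrightarrow> c \<le> c1"
    by (metis (mono_tags, lifting) bdd_above.E bdd_above_finite case_prod_conv image_eqI)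
  \<comment> \<open>Beyond \<open>n\<close> no triple is exceptional and the asymptotic estimate
    holds; up to \<open>n\<close>, \<open>c \<le> n < 2 ^ n\<close> suffices because the radical is
    at least 2.\<close>
  define n :: nat where "n = nat (max \<lceil>x0\<rceil> c1)"
  define M :: real where "M = max 2 (max (1 / \<delta>) (real n))"
  have M: "M \<ge> 2" "M \<ge> 1 / \<delta>" "M \<ge> real n" by (auto simp: M_def)
  have "real_of_int c < real_of_int (rad (a * b * c)) powr M" if abc: "abc_triple a b c" for a b c
  proof -
    note * = abc_tripleD[OF abc]
    define r where "r = real_of_int (rad (a * b * c))"
    have r: "r \<ge> 2" using two_le_rad[OF abc] by (simp add: r_def)
    consider "one_N_prime_form a b c" | "c \<le> int n"
      | "c > int n" "\<not> one_N_prime_form a b c" by linarith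
    then have "real_of_int c < r powr M"
    proof cases
      case 1
      have "real_of_int c < real_of_int (rad (a * b * c) ^ 2)"
        using one_N_prime_form_less[OF abc 1] by linarith
      also have "\<dots> = r powr 2" using r by (simp add: r_def powr_numeral)
      also have "\<dots> \<le> r powr M" using r M by (intro powr_mono) auto
      finally show ?thesis .
    next
      case 2
      have "real_of_int c \<le> real n" using 2 by linarith
      also have "real n < 2 ^ n" by (rule of_nat_less_two_power)
      also have "(2::real) ^ n = 2 powr real n" by (simp add: powr_realpow)
      also have "\<dots> \<le> r powr real n" using r by (intro powr_mono2) auto
      also have "\<dots> \<le> r powr M" using r M by (intro powr_mono) auto
      finally show ?thesis .
    next
      case 3
      have "c1 < c" using 3(1) unfolding n_def by linarith
      then have "(a, b, c) \<notin> ?bad \<eta>" using c1 leD by blast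
      then obtain \<psi> where \<psi>: "\<psi> \<in> derivations a b" "psi_independent \<psi> a b"
          "psi_norm \<psi> < ereal (real_of_int c powr \<eta>)"
        using abc 3 by blast
      have x0c: "real_of_int c \<ge> x0" using 3(1) unfolding n_def by linarith
      have "real_of_int c \<le> 2 * (real_of_int c powr \<eta>) * log 2 (real_of_int c) * r"
        using c_le_rad_of_derivation[OF abc \<psi>(1,2) less_imp_le[OF \<psi>(3)]] by (simp add: r_def)
      also have "\<dots> = (real_of_int c powr \<eta> * r) * (2 * log 2 (real_of_int c))" by simp
      also have "\<dots> < (real_of_int c powr \<eta> * r) * real_of_int c powr \<delta>"
        using x0[OF x0c] * r by (intro mult_strict_left_mono) auto
      also have "\<dots> = real_of_int c powr (\<eta> + \<delta>) * r" by (simp add: powr_add)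
      finally have "real_of_int c powr (\<eta> + \<delta> + \<delta>) < real_of_int c powr (\<eta> + \<delta>) * r"
        using * by (simp add: \<delta>_def)
      then have "real_of_int c powr (\<eta> + \<delta>) * real_of_int c powr \<delta> <
          real_of_int c powr (\<eta> + \<delta>) * r"
        by (simp only: powr_add[of _ "\<eta> + \<delta>" \<delta>])
      then have "real_of_int c powr \<delta> < r"
        by (rule mult_left_less_imp_less) simp
      then have "(real_of_int c powr \<delta>) powr (1 / \<delta>) < r powr (1 / \<delta>)"
        using \<delta> by (intro powr_less_mono2) auto
      then have "real_of_int c < r powr (1 / \<delta>)"
        using \<delta> * by (simp add: powr_powr)
      also have "\<dots> \<le> r powr M" using r M by (intro powr_mono) auto
      finally show ?thesis .
    qed
    then show ?thesis by (simp add: r_def)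
  qed
  then show ?thesis unfolding Oesterle_conjecture_def by blast
qed

section \<open>Triples with a large prime factor\<close>

text \<open>Siegel's lemma by pigeonhole: the form maps the \<open>(H + 1) ^ 3\<close> points of a
  box to at most \<open>H ^ 3 + 1\<close> integers, and the difference of two points with equal
  value is a solution.\<close>

lemma siegel_three_variables:
  fixes A B C H :: int
  assumes "H \<ge> 1" and bound: "\<bar>A\<bar> + \<bar>B\<bar> + \<bar>C\<bar> \<le> H\<^sup>2"
  obtains u v w where "\<bar>u\<bar> \<le> H" "\<bar>v\<bar> \<le> H" "\<bar>w\<bar> \<le> H" "(u, v, w) \<noteq> (0, 0, 0)"
    "A * u + B * v + C * w = 0"
proof -
  define f where "f = (\<lambda>(u, v, w). A * u + B * v + C * w)"
  \<comment> \<open>The minimum of the form on the box: variables with negative coefficient are set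
    to \<open>H\<close>, the others to 0.\<close>
  define lo where "lo = - H * (max 0 (- A) + max 0 (- B) + max 0 (- C))"
  let ?box = "{0..H} \<times> {0..H} \<times> {0..H}"
  have range1: "- H * max 0 (- D) \<le> D * u \<and> D * u \<le> H * \<bar>D\<bar> - H * max 0 (- D)"
    if "u \<in> {0..H}" for D u :: int
  proof (cases "D \<ge> 0")
    case True
    have "D * u \<le> D * H" "0 \<le> D * u" using True that by (auto intro: mult_left_mono)
    then show ?thesis using True by (simp add: mult.commute)
  next
    case False
    have "D * u \<ge> D * H" "D * u \<le> 0"
      using False that by (auto intro: mult_left_mono_neg mult_nonpos_nonneg)
    then show ?thesis using False by (simp add: mult.commute)
  qed
  have "f ` ?box \<subseteq> {lo..lo + H * H\<^sup>2}"
  proof (clarsimp simp: f_def)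
    fix u v w assume "0 \<le> u" "u \<le> H" "0 \<le> v" "v \<le> H" "0 \<le> w" "w \<le> H"
    then have "lo \<le> A * u + B * v + C * w \<and>
        A * u + B * v + C * w \<le> lo + H * (\<bar>A\<bar> + \<bar>B\<bar> + \<bar>C\<bar>)"
      using range1[of u A] range1[of v B] range1[of w C]
      by (auto simp: lo_def algebra_simps)
    moreover have "H * (\<bar>A\<bar> + \<bar>B\<bar> + \<bar>C\<bar>) \<le> H * H\<^sup>2"
      using assms by (intro mult_left_mono) auto
    ultimately show "lo \<le> A * u + B * v + C * w \<and> A * u + B * v + C * w \<le> lo + H * H\<^sup>2"
      by linarith
  qed
  then have "card (f ` ?box) \<le> card {lo..lo + H * H\<^sup>2}"
    by (intro card_mono) auto
  also have "\<dots> = nat (H * H\<^sup>2 + 1)" by simp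
  also have "\<dots> < nat ((H + 1) * ((H + 1) * (H + 1)))"
  proof -
    have "(H + 1) * ((H + 1) * (H + 1)) = H * H\<^sup>2 + 1 + 3 * H\<^sup>2 + 3 * H"
      by (simp add: algebra_simps power2_eq_square)
    moreover have "0 \<le> H\<^sup>2" "0 \<le> H * H\<^sup>2" using assms(1) by simp_all
    ultimately show ?thesis using assms(1) by linarith
  qed
  also have "\<dots> = card ?box"
    using assms(1) by (simp add: card_cartesian_product nat_mult_distrib)
  finally have "\<not> inj_on f ?box" by (rule pigeonhole)
  then obtain s t where st: "s \<in> ?box" "t \<in> ?box" "f s = f t" "s \<noteq> t"
    by (meson inj_onI)
  obtain s1 s2 s3 where s: "s = (s1, s2, s3)" by (cases s)
  obtain t1 t2 t3 where t: "t = (t1, t2, t3)" by (cases t)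
  have "s1 \<in> {0..H}" "s2 \<in> {0..H}" "s3 \<in> {0..H}" "t1 \<in> {0..H}" "t2 \<in> {0..H}" "t3 \<in> {0..H}"
    using st(1,2) by (auto simp: s t)
  then have "\<bar>s1 - t1\<bar> \<le> H" "\<bar>s2 - t2\<bar> \<le> H" "\<bar>s3 - t3\<bar> \<le> H" by auto
  moreover have "(s1 - t1, s2 - t2, s3 - t3) \<noteq> (0, 0, 0)" using st(4) by (simp add: s t)
  moreover have "A * (s1 - t1) + B * (s2 - t2) + C * (s3 - t3) = 0"
    using st(3) by (simp add: s t f_def right_diff_distrib)
  ultimately show ?thesis by (rule that)
qed

text \<open>Lets the logarithmic derivatives of all three entries be summed over one common set of
  primes.\<close>

lemma log_deriv_eq_sum:
  assumes "finite S" "\<And>p. p \<in> S \<Longrightarrow> prime p" "\<And>p. t p \<noteq> 0 \<Longrightarrow> p \<in> S" "n \<noteq> 0"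
  shows "log_deriv t n =
         (\<Sum>p\<in>S. real (multiplicity p n) * real_of_int (t p) / real_of_int p)"
proof -
  let ?f = "\<lambda>p. real (multiplicity p n) * real_of_int (t p) / real_of_int p"
  have "multiplicity p n = 0" if "p \<in> S" "p \<notin> prime_factors n" for p
    using that assms(2) by (simp add: prime_factors_multiplicity)
  then have "sum ?f (prime_factors n) = sum ?f (prime_factors n \<union> S)"
    using assms(1) by (intro sum.mono_neutral_left) auto
  also have "\<dots> = sum ?f S"
    using assms(1,3) by (intro sum.mono_neutral_right) auto
  finally show ?thesis by (simp add: log_deriv_def)
qed

text \<open>For \<open>t\<close> supported at three primes the relation is one integer linear
  equation with coefficients at most \<open>3 * c * log 2 c\<close> in absolute value, so Siegel's
  lemma applies. Ruling out equal logarithmic derivatives is left to the choice of primes.\<close>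

lemma three_prime_solution:
  fixes p q r x y z H :: int and c :: real
  assumes primes: "prime p" "prime q" "prime r" and distinct: "p \<noteq> q" "p \<noteq> r" "q \<noteq> r"
    and nz: "x \<noteq> 0" "y \<noteq> 0" "z \<noteq> 0"
    and le: "real_of_int \<bar>x\<bar> \<le> c" "real_of_int \<bar>y\<bar> \<le> c" "real_of_int \<bar>z\<bar> \<le> c"
    and H: "H \<ge> 1" "9 * c * log 2 c \<le> (real_of_int H)\<^sup>2"
  obtains t where "\<And>u. \<bar>t u\<bar> \<le> H" "\<And>u. t u \<noteq> 0 \<Longrightarrow> u \<in> {p, q, r}" "\<exists>u. t u \<noteq> 0"
    "real_of_int x * log_deriv t x + real_of_int y * log_deriv t y +
       real_of_int z * log_deriv t z = 0"
proof -
  \<comment> \<open>The coefficient of \<open>t u\<close> in the relation; the divisions are exact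
    by \<open>dvd_mult_multiplicity\<close>.\<close>
  define A where "A = (\<lambda>u. (x * int (multiplicity u x)) div u +
    (y * int (multiplicity u y)) div u + (z * int (multiplicity u z)) div u)"
  have c: "c \<ge> 1" using le(1) nz(1) by linarith
  have A: "real_of_int (A u) = (real_of_int x * real (multiplicity u x) +
      real_of_int y * real (multiplicity u y) + real_of_int z * real (multiplicity u z)) / real_of_int u" for u
    by (simp add: A_def real_of_int_div dvd_mult_multiplicity add_divide_distrib)
  have term_le: "\<bar>real_of_int n * real (multiplicity u n)\<bar> \<le> c * log 2 c"
    if "prime u" "n \<noteq> 0" "real_of_int \<bar>n\<bar> \<le> c" for u n :: int
    unfolding abs_mult
    using multiplicity_le_log[of n c u] that c by (intro mult_mono) auto
  have A_le: "real_of_int \<bar>A u\<bar> \<le> 3 * c * log 2 c" if u: "prime u" for u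
  proof -
    have "real_of_int u \<ge> 1" using prime_ge_1_int[OF u] by simp
    then have "real_of_int \<bar>A u\<bar> \<le> \<bar>real_of_int x * real (multiplicity u x) +
      real_of_int y * real (multiplicity u y) + real_of_int z * real (multiplicity u z)\<bar>"
      by (simp add: A abs_divide divide_le_eq mult_le_cancel_left1)
    then show ?thesis
      using term_le[OF u nz(1) le(1)] term_le[OF u nz(2) le(2)] term_le[OF u nz(3) le(3)] by linarith
  qed
  have "real_of_int (\<bar>A p\<bar> + \<bar>A q\<bar> + \<bar>A r\<bar>) \<le> real_of_int (H\<^sup>2)"
    using A_le[OF primes(1)] A_le[OF primes(2)] A_le[OF primes(3)] H(2) by simp
  then have "\<bar>A p\<bar> + \<bar>A q\<bar> + \<bar>A r\<bar> \<le> H\<^sup>2" by linarith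
  from siegel_three_variables[OF H(1) this] obtain t1 t2 t3 where
    t: "\<bar>t1\<bar> \<le> H" "\<bar>t2\<bar> \<le> H" "\<bar>t3\<bar> \<le> H" "(t1, t2, t3) \<noteq> (0, 0, 0)"
       "A p * t1 + A q * t2 + A r * t3 = 0" by blast
  define t where "t = (\<lambda>u. if u = p then t1 else if u = q then t2 else if u = r then t3 else 0)"
  have L: "log_deriv t n = (\<Sum>u\<in>{p, q, r}. real (multiplicity u n) * real_of_int (t u) / real_of_int u)"
    if "n \<noteq> 0" for n
    by (rule log_deriv_eq_sum) (use that primes in \<open>auto simp: t_def split: if_splits\<close>)
  have tv: "t p = t1" "t q = t2" "t r = t3" using distinct by (auto simp: t_def)
  show ?thesis
  proof (rule that[of t])
    show "\<bar>t u\<bar> \<le> H" for u using t H by (auto simp: t_def)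
    show "t u \<noteq> 0 \<Longrightarrow> u \<in> {p, q, r}" for u by (auto simp: t_def split: if_splits)
    show "\<exists>u. t u \<noteq> 0" using t(4) tv by auto
    have "real_of_int x * log_deriv t x + real_of_int y * log_deriv t y + real_of_int z * log_deriv t z =
        real_of_int (A p) * real_of_int t1 + real_of_int (A q) * real_of_int t2 + real_of_int (A r) * real_of_int t3"
      using distinct nz by (simp add: L tv A add_divide_distrib algebra_simps)
    also have "\<dots> = 0" using t(5) by (metis of_int_0 of_int_add of_int_mult)
    finally show "real_of_int x * log_deriv t x + real_of_int y * log_deriv t y +
       real_of_int z * log_deriv t z = 0" .
  qed
qed

text \<open>One prime is taken from each entry, so each logarithmic derivative has a single term.
  Equality of the first two would give \<open>p dvd t p\<close>; as \<open>H < p\<close>, this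
  forces \<open>t p = 0\<close>, and then \<open>t\<close> vanishes altogether.\<close>

lemma small_solution_large_prime_nonunits:
  fixes p x y z H :: int and c :: real
  assumes nz: "x \<noteq> 0" "y \<noteq> 0" "z \<noteq> 0"
    and cop: "coprime x y" "coprime x z" "coprime y z"
    and le: "real_of_int \<bar>x\<bar> \<le> c" "real_of_int \<bar>y\<bar> \<le> c" "real_of_int \<bar>z\<bar> \<le> c"
    and H: "H \<ge> 1" "9 * c * log 2 c \<le> (real_of_int H)\<^sup>2"
    and p: "prime p" "p dvd x" "multiplicity p x = 1" "H < p"
    and nonunit: "\<not> is_unit y" "\<not> is_unit z"
  shows "small_solution (real_of_int H) x y z"
proof -
  obtain q where q: "prime q" "q dvd y" using nonunit(1) nz(2) prime_divisor_exists by blast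
  obtain r where r: "prime r" "r dvd z" using nonunit(2) nz(3) prime_divisor_exists by blast
  have ndvd: "\<not> p dvd y" "\<not> p dvd z" "\<not> q dvd x" "\<not> q dvd z" "\<not> r dvd x" "\<not> r dvd y"
    using p q r cop by (meson coprime_common_divisor not_prime_unit)+
  then have distinct: "p \<noteq> q" "p \<noteq> r" "q \<noteq> r" using p q r by auto
  obtain t where t: "\<And>u. \<bar>t u\<bar> \<le> H" "\<And>u. t u \<noteq> 0 \<Longrightarrow> u \<in> {p, q, r}" "\<exists>u. t u \<noteq> 0"
    "real_of_int x * log_deriv t x + real_of_int y * log_deriv t y + real_of_int z * log_deriv t z = 0"
    using three_prime_solution[OF p(1) q(1) r(1) distinct nz le H] by blast
  have L: "log_deriv t n = (\<Sum>u\<in>{p, q, r}. real (multiplicity u n) * real_of_int (t u) / real_of_int u)"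
    if "n \<noteq> 0" for n
    by (rule log_deriv_eq_sum) (use that p q r t in auto)
  define v w where "v = multiplicity q y" and "w = multiplicity r z"
  have vw: "v > 0" "w > 0"
    using q r nz by (auto simp: v_def w_def prime_multiplicity_gt_zero_iff)
  have Lx: "log_deriv t x = real_of_int (t p) / real_of_int p"
    using distinct nz p ndvd by (simp add: L not_dvd_imp_multiplicity_0)
  have Ly: "log_deriv t y = real v * real_of_int (t q) / real_of_int q"
    using distinct nz p ndvd by (simp add: L not_dvd_imp_multiplicity_0 v_def)
  have Lz: "log_deriv t z = real w * real_of_int (t r) / real_of_int r"
    using distinct nz p ndvd by (simp add: L not_dvd_imp_multiplicity_0 w_def)
  have pos: "p > 0" "q > 0" "r > 0" using p q r prime_gt_0_int by auto
  have "\<not> (log_deriv t x = log_deriv t y \<and> log_deriv t y = log_deriv t z)"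
  proof
    assume eq: "log_deriv t x = log_deriv t y \<and> log_deriv t y = log_deriv t z"
    then have "real_of_int (t p * q) = real_of_int (p * (int v * t q))"
      using pos by (simp add: Lx Ly field_simps)
    then have "p dvd t p * q" by (metis dvd_triv_left of_int_eq_iff)
    moreover have "\<not> p dvd q" using p(1) q(1) distinct(1) primes_dvd_imp_eq by blast
    ultimately have "p dvd t p" using p(1) by (simp add: prime_dvd_mult_iff)
    then have "t p = 0" using t(1)[of p] p(4) dvd_imp_le_int[of "t p" p] by fastforce
    then have "log_deriv t x = 0" by (simp add: Lx)
    then have "t q = 0" "t r = 0" using eq vw pos by (auto simp: Ly Lz)
    then show False using \<open>t p = 0\<close> t(2,3) by fastforce
  qed
  moreover have "u dvd x * y * z" if "t u \<noteq> 0" for u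
    using t(2)[OF that] p q r by auto
  moreover have "real_of_int \<bar>t u\<bar> \<le> real_of_int H" for u
    using t(1) by (simp only: of_int_le_iff)
  ultimately show ?thesis
    unfolding small_solution_def using t(4) by blast
qed

text \<open>The unit \<open>z\<close> has no prime factor, so the second prime comes from the
  cofactor of \<open>p\<close> in \<open>x\<close>, which is not a unit because
  \<open>\<bar>x\<bar> \<noteq> p\<close>. As \<open>log_deriv t z = 0\<close>, equality of all
  three would make all of them zero.\<close>

lemma small_solution_large_prime_unit:
  fixes p x y z H :: int and c :: real
  assumes nz: "x \<noteq> 0" "y \<noteq> 0" "z \<noteq> 0"
    and cop: "coprime x y" "coprime x z" "coprime y z"
    and le: "real_of_int \<bar>x\<bar> \<le> c" "real_of_int \<bar>y\<bar> \<le> c" "real_of_int \<bar>z\<bar> \<le> c"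
    and H: "H \<ge> 1" "9 * c * log 2 c \<le> (real_of_int H)\<^sup>2"
    and p: "prime p" "p dvd x" "multiplicity p x = 1" "H < p"
    and unit: "\<not> is_unit y" "is_unit z" and neq: "\<bar>x\<bar> \<noteq> p"
  shows "small_solution (real_of_int H) x y z"
proof -
  obtain m where m: "x = p * m" using p(2) by blast
  have pos_p: "p > 0" using p(1) by (rule prime_gt_0_int)
  have "\<not> is_unit m" using neq m pos_p by (auto simp: abs_mult)
  moreover have "m \<noteq> 0" using m nz by auto
  ultimately obtain q where q: "prime q" "q dvd m" using prime_divisor_exists by blast
  obtain r where r: "prime r" "r dvd y" using unit(1) nz(2) prime_divisor_exists by blast
  have "q dvd x" using q m by simp
  have "p \<noteq> q"
  proof
    assume "p = q"
    then have "p ^ 2 dvd x" using q m by (simp add: power2_eq_square mult_dvd_mono)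
    then have "2 \<le> multiplicity p x"
      using nz(1) p(1) by (intro multiplicity_geI) auto
    then show False using p(3) by simp
  qed
  have ndvd: "\<not> p dvd y" "\<not> q dvd y" "\<not> r dvd x"
    using p q r cop \<open>q dvd x\<close> by (meson coprime_common_divisor not_prime_unit)+
  then have distinct: "p \<noteq> q" "p \<noteq> r" "q \<noteq> r" using p q r \<open>p \<noteq> q\<close> by auto
  obtain t where t: "\<And>u. \<bar>t u\<bar> \<le> H" "\<And>u. t u \<noteq> 0 \<Longrightarrow> u \<in> {p, q, r}" "\<exists>u. t u \<noteq> 0"
    "real_of_int x * log_deriv t x + real_of_int y * log_deriv t y + real_of_int z * log_deriv t z = 0"
    using three_prime_solution[OF p(1) q(1) r(1) distinct nz le H] by blast
  have L: "log_deriv t n = (\<Sum>u\<in>{p, q, r}. real (multiplicity u n) * real_of_int (t u) / real_of_int u)"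
    if "n \<noteq> 0" for n
    by (rule log_deriv_eq_sum) (use that p q r t in auto)
  define v w where "v = multiplicity q x" and "w = multiplicity r y"
  have vw: "v > 0" "w > 0"
    using q r nz \<open>q dvd x\<close> by (auto simp: v_def w_def prime_multiplicity_gt_zero_iff)
  have Lx: "log_deriv t x = real_of_int (t p) / real_of_int p + real v * real_of_int (t q) / real_of_int q"
    using distinct nz p ndvd by (simp add: L not_dvd_imp_multiplicity_0 v_def)
  have Ly: "log_deriv t y = real w * real_of_int (t r) / real_of_int r"
    using distinct nz p ndvd by (simp add: L not_dvd_imp_multiplicity_0 w_def)
  have Lz: "log_deriv t z = 0"
    using unit(2) log_deriv_minus[of t 1] by (auto simp: abs_if split: if_splits)
  have pos: "p > 0" "q > 0" "r > 0" using p q r prime_gt_0_int by auto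
  have "\<not> (log_deriv t x = log_deriv t y \<and> log_deriv t y = log_deriv t z)"
  proof
    assume eq: "log_deriv t x = log_deriv t y \<and> log_deriv t y = log_deriv t z"
    then have "t r = 0" using vw pos by (auto simp: Ly Lz)
    \<comment> \<open>Vanishing of \<open>log_deriv t x\<close> reads
      \<open>t p / p = - v * t q / q\<close>, so again \<open>p\<close> divides
      \<open>t p\<close>.\<close>
    have x0: "log_deriv t x = 0" using eq Lz by simp
    then have "real_of_int (t p * q) = real_of_int (p * (- int v * t q))"
      using pos by (simp add: Lx field_simps)
    then have "p dvd t p * q" by (metis dvd_triv_left of_int_eq_iff)
    moreover have "\<not> p dvd q" using p(1) q(1) distinct(1) primes_dvd_imp_eq by blast
    ultimately have "p dvd t p" using p(1) by (simp add: prime_dvd_mult_iff)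
    then have "t p = 0" using t(1)[of p] p(4) dvd_imp_le_int[of "t p" p] by fastforce
    then have "t q = 0" using x0 vw pos by (auto simp: Lx)
    then show False using \<open>t p = 0\<close> \<open>t r = 0\<close> t(2,3) by fastforce
  qed
  moreover have "u dvd x * y * z" if "t u \<noteq> 0" for u
    using t(2)[OF that] p \<open>q dvd x\<close> r by auto
  moreover have "real_of_int \<bar>t u\<bar> \<le> real_of_int H" for u
    using t(1) by (simp only: of_int_le_iff)
  ultimately show ?thesis
    unfolding small_solution_def using t(4) by blast
qed

text \<open>The condition \<open>p ^ 2 > c\<close> makes the valuation of \<open>p\<close> in
  \<open>x\<close> equal to 1; what remains is which of the other entries, if any, is a
  unit.\<close>

lemma small_solution_large_prime:
  fixes p x y z H :: int and c :: real
  assumes nz: "x \<noteq> 0" "y \<noteq> 0" "z \<noteq> 0"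
    and cop: "coprime x y" "coprime x z" "coprime y z"
    and le: "real_of_int \<bar>x\<bar> \<le> c" "real_of_int \<bar>y\<bar> \<le> c" "real_of_int \<bar>z\<bar> \<le> c"
    and H: "H \<ge> 1" "9 * c * log 2 c \<le> (real_of_int H)\<^sup>2"
    and p: "prime p" "p dvd x" "H < p" "real_of_int p ^ 2 > c"
    and units: "\<not> (is_unit y \<and> is_unit z)" "is_unit y \<or> is_unit z \<Longrightarrow> \<bar>x\<bar> \<noteq> p"
  shows "small_solution (real_of_int H) x y z"
proof -
  have "multiplicity p x < 2"
  proof (rule multiplicity_lessI)
    show "\<not> p ^ 2 dvd x"
    proof
      assume "p ^ 2 dvd x"
      then have "p ^ 2 \<le> \<bar>x\<bar>" using nz(1) zdvd_imp_le[of "p ^ 2" "\<bar>x\<bar>"] by simp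
      then have "real_of_int (p ^ 2) \<le> real_of_int \<bar>x\<bar>" by linarith
      then show False using p(4) le(1) by simp
    qed
  qed (use nz p in auto)
  moreover have "multiplicity p x > 0"
    using p nz by (auto simp: prime_multiplicity_gt_zero_iff)
  ultimately have mult: "multiplicity p x = 1" by linarith
  consider "\<not> is_unit y" "\<not> is_unit z" | "\<not> is_unit y" "is_unit z" | "is_unit y" "\<not> is_unit z"
    using units by blast
  then show ?thesis
  proof cases
    case 1
    then show ?thesis
      using small_solution_large_prime_nonunits[OF nz cop le H p(1,2) mult p(3)] by blast
  next
    case 2
    then show ?thesis
      using small_solution_large_prime_unit[OF nz cop le H p(1,2) mult p(3)] units by blast
  next
    case 3
    have "coprime z y" using cop(3) by (simp add: coprime_commute)
    with 3 show ?thesis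
      using small_solution_large_prime_unit[OF nz(1,3,2) cop(2,1) _ le(1,3,2) H p(1,2) mult p(3)] units
      by (subst small_solution_swap23) blast
  qed
qed

section \<open>Triples with only small prime factors\<close>

text \<open>Division with remainder gives \<open>v \<le> k * (v div k + 1)\<close>, and
  \<open>m + 1 \<le> 2 ^ m\<close> for the quotient \<open>m\<close>.\<close>

lemma power_le_two_power:
  fixes v k :: nat
  assumes "k > 0"
  shows "v ^ k \<le> k ^ k * 2 ^ v"
proof -
  have "v \<le> k * (v div k + 1)"
    using assms by (metis add.commute dividend_less_div_times less_imp_le mult.commute mult_Suc_right plus_1_eq_Suc)
  also have "\<dots> \<le> k * 2 ^ (v div k)"
    by (intro mult_left_mono) (simp_all add: Suc_leI)
  finally have "v ^ k \<le> (k * 2 ^ (v div k)) ^ k" by (rule power_mono) simp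
  also have "\<dots> = k ^ k * 2 ^ (v div k * k)" by (simp add: power_mult_distrib power_mult)
  also have "\<dots> \<le> k ^ k * 2 ^ v"
    by (intro mult_left_mono power_increasing) auto
  finally show ?thesis .
qed

text \<open>As in the divisor bound, a prime \<open>p \<ge> 2 ^ k\<close> with valuation
  \<open>v\<close> satisfies \<open>v ^ k \<le> (2 ^ k) ^ v \<le> p ^ v\<close>, so only the
  boundedly many smaller primes cost a factor \<open>k ^ k\<close> each.\<close>

lemma prod_multiplicity_power_le:
  fixes k :: nat
  assumes "k > 0"
  obtains C :: int where "C \<ge> 1"
    "\<And>n :: int. n \<noteq> 0 \<Longrightarrow> (\<Prod>p\<in>prime_factors n. int (multiplicity p n)) ^ k \<le> C * \<bar>n\<bar>"
proof (rule that[of "(int k ^ k) ^ (2 ^ k)"])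
  have kk: "int k ^ k \<ge> 1" using assms by (simp add: one_le_power)
  then show "(int k ^ k) ^ (2 ^ k) \<ge> 1" by (rule one_le_power)
  fix n :: int assume n: "n \<noteq> 0"
  let ?P = "prime_factors n" and ?v = "\<lambda>p. multiplicity p n"
  let ?g = "\<lambda>p::int. if p < 2 ^ k then int k ^ k else 1"
  have term_le: "int (?v p) ^ k \<le> ?g p * p ^ ?v p" if "p \<in> ?P" for p
  proof (cases "p < 2 ^ k")
    case True
    have "p \<ge> 2" using that by (auto simp: in_prime_factors_iff dest: prime_ge_2_int)
    then have "(2::int) ^ ?v p \<le> p ^ ?v p" by (intro power_mono) auto
    have "int (?v p ^ k) \<le> int (k ^ k * 2 ^ ?v p)"
      using power_le_two_power[OF assms] by (rule zle_int[THEN iffD2])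
    also have "\<dots> = int k ^ k * 2 ^ ?v p" by simp
    also have "\<dots> \<le> int k ^ k * p ^ ?v p"
      using \<open>2 ^ ?v p \<le> p ^ ?v p\<close> by (intro mult_left_mono) auto
    finally show ?thesis using True by simp
  next
    case False
    have "int (?v p) ^ k \<le> (2 ^ ?v p) ^ k"
      by (intro power_mono) (auto simp: less_imp_le of_nat_less_two_power)
    also have "\<dots> = (2 ^ k) ^ ?v p" by (simp add: power_mult[symmetric] mult.commute)
    also have "\<dots> \<le> p ^ ?v p" using False by (intro power_mono) auto
    finally show ?thesis using False by simp
  qed
  have "prod ?g ?P = (int k ^ k) ^ card (?P \<inter> {p. p < 2 ^ k})"
    by (simp add: prod.If_cases)
  also have "\<dots> \<le> (int k ^ k) ^ (2 ^ k)"
  proof (intro power_increasing kk)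
    have "card (?P \<inter> {p. p < 2 ^ k}) \<le> card {0..<2 ^ k :: int}"
      by (intro card_mono) (auto simp: in_prime_factors_iff dest: prime_ge_0_int)
    then show "card (?P \<inter> {p. p < 2 ^ k}) \<le> 2 ^ k" by (simp add: nat_power_eq)
  qed
  finally have g: "prod ?g ?P \<le> (int k ^ k) ^ (2 ^ k)" .
  have "(\<Prod>p\<in>?P. int (?v p)) ^ k = (\<Prod>p\<in>?P. int (?v p) ^ k)"
    by (rule prod_power_distrib)
  also have "\<dots> \<le> (\<Prod>p\<in>?P. ?g p * p ^ ?v p)"
    using term_le by (intro prod_mono) auto
  also have "\<dots> = prod ?g ?P * (\<Prod>p\<in>?P. p ^ ?v p)" by (rule prod.distrib)
  also have "(\<Prod>p\<in>?P. p ^ ?v p) = \<bar>n\<bar>" using n by (simp add: prod_prime_factors)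
  also have "prod ?g ?P * \<bar>n\<bar> \<le> (int k ^ k) ^ (2 ^ k) * \<bar>n\<bar>"
    using g by (intro mult_right_mono) auto
  finally show "(\<Prod>p\<in>?P. int (?v p)) ^ k \<le> (int k ^ k) ^ (2 ^ k) * \<bar>n\<bar>" .
qed

section \<open>Partial fractions with bounded numerators\<close>

text \<open>Each induction step splits off one prime by Bezout. Its numerator is reduced modulo the
  prime, the quotient is moved to the remaining fraction, and \<open>k\<close> collects what is left
  at the end.\<close>

lemma partial_fractions:
  fixes P :: "int set" and X :: int
  assumes "finite P" "\<And>p. p \<in> P \<Longrightarrow> prime p"
  shows "\<exists>s k. (\<forall>p\<in>P. 0 \<le> s p \<and> s p < p) \<and>
    (\<Sum>p\<in>P. real_of_int (s p) / real_of_int p) + real_of_int k = real_of_int X / real_of_int (\<Prod>P)"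
  using assms
proof (induction P arbitrary: X rule: finite_induct)
  case empty
  show ?case by (intro exI[of _ "\<lambda>_. 0"] exI[of _ X]) simp
next
  case (insert q P)
  have q: "prime q" and q_pos: "q > 0" using insert.prems prime_gt_0_int by auto
  have P_pos: "\<Prod>P > 0" by (intro prod_pos) (use insert.prems prime_gt_0_int in auto)
  have "coprime (\<Prod>P) q"
    using insert q by (intro prod_coprime_left) (auto intro!: primes_coprime)
  then obtain i j where ij: "i * \<Prod>P + j * q = 1"
    using bezout_int[of "\<Prod>P" q] by (auto simp: coprime_iff_gcd_eq_1)
  define u where "u = (X * i) mod q"
  define w where "w = (X * i) div q"
  define v where "v = X * j + w * \<Prod>P"
  have wu: "w * q + u = X * i" by (simp add: w_def u_def)
  have "u * \<Prod>P + v * q = (w * q + u) * \<Prod>P + X * j * q"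
    by (simp add: v_def algebra_simps)
  also have "\<dots> = X * (i * \<Prod>P + j * q)"
    unfolding wu by (simp add: algebra_simps)
  finally have uv: "u * \<Prod>P + v * q = X" by (simp add: ij)
  obtain s k where s: "\<forall>p\<in>P. 0 \<le> s p \<and> s p < p"
    "(\<Sum>p\<in>P. real_of_int (s p) / real_of_int p) + real_of_int k = real_of_int v / real_of_int (\<Prod>P)"
    using insert.IH[of v] insert.prems by blast
  have "(\<Sum>p\<in>insert q P. real_of_int ((s(q := u)) p) / real_of_int p) + real_of_int k =
      real_of_int u / real_of_int q + real_of_int v / real_of_int (\<Prod>P)"
  proof -
    have "(\<Sum>p\<in>P. real_of_int ((s(q := u)) p) / real_of_int p) =
        (\<Sum>p\<in>P. real_of_int (s p) / real_of_int p)"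
      using insert.hyps(2) by (intro sum.cong) auto
    then show ?thesis using s(2) by (subst sum.insert[OF insert.hyps]) simp
  qed
  also have "\<dots> = real_of_int (u * \<Prod>P + v * q) / real_of_int (q * \<Prod>P)"
  proof -
    have "x / r + y / s = (x * s + y * r) / (r * s)" if "r > 0" "s > 0" for x y r s :: real
      using that by (simp add: add_divide_distrib)
    moreover have "real_of_int q > 0" "real_of_int (\<Prod>P) > 0"
      using q_pos P_pos by (simp_all only: of_int_0_less_iff)
    ultimately show ?thesis by (simp only: of_int_add of_int_mult)
  qed
  also have "\<dots> = real_of_int X / real_of_int (\<Prod>(insert q P))"
    using insert.hyps by (simp add: uv)
  finally show ?case
    using s(1) q_pos by (intro exI[of _ "s(q := u)"] exI[of _ k]) (auto simp: u_def)
qed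

text \<open>The integer part \<open>k\<close> is absorbed by the numerator at one prime, which is
  why an empty \<open>P\<close> allows only \<open>X = 0\<close>. The reduced fractions lie between
  0 and 1, which bounds \<open>k\<close>.\<close>

lemma partial_fractions_bounded:
  fixes P :: "int set" and X :: int
  assumes "finite P" "\<And>p. p \<in> P \<Longrightarrow> prime p" "X \<ge> 0" "P = {} \<Longrightarrow> X = 0"
  shows "\<exists>s. (\<forall>p\<in>P. \<bar>real_of_int (s p)\<bar> \<le>
        real_of_int p * (1 + real (card P) + real_of_int X / real_of_int (\<Prod>P))) \<and>
      (\<Sum>p\<in>P. real_of_int (s p) / real_of_int p) = real_of_int X / real_of_int (\<Prod>P)"
proof (cases "P = {}")
  case True
  then show ?thesis using assms by simp
next
  case False
  then obtain q where q: "q \<in> P" by blast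
  let ?Y = "real_of_int X / real_of_int (\<Prod>P)"
  have pos: "p > 0" if "p \<in> P" for p using assms(2)[OF that] by (rule prime_gt_0_int)
  have "\<Prod>P > 0" by (intro prod_pos) (use pos in auto)
  then have Y: "?Y \<ge> 0" using assms(3)
    by (intro divide_nonneg_pos) (simp_all only: of_int_0_le_iff of_int_0_less_iff)
  obtain s k where s: "\<forall>p\<in>P. 0 \<le> s p \<and> s p < p"
    and sum: "(\<Sum>p\<in>P. real_of_int (s p) / real_of_int p) + real_of_int k = ?Y"
    using partial_fractions[OF assms(1,2)] by blast
  have "(\<Sum>p\<in>P. real_of_int (s p) / real_of_int p) \<le> (\<Sum>p\<in>P. 1)"
    using s pos by (intro sum_mono) (simp add: less_imp_le)
  moreover have "(\<Sum>p\<in>P. real_of_int (s p) / real_of_int p) \<ge> 0"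
    using s pos by (intro sum_nonneg divide_nonneg_nonneg) (auto simp: less_imp_le)
  ultimately have k: "\<bar>real_of_int k\<bar> \<le> real (card P) + ?Y"
    using sum Y by simp
  let ?s = "s(q := s q + k * q)"
  show ?thesis
  proof (intro exI[of _ ?s] conjI ballI)
    fix p assume p: "p \<in> P"
    have "\<bar>?s p\<bar> \<le> p + \<bar>k\<bar> * p"
    proof (cases "p = q")
      case True
      have "\<bar>s q + k * q\<bar> \<le> \<bar>s q\<bar> + \<bar>k * q\<bar>" by (rule abs_triangle_ineq)
      then show ?thesis using True s p pos[OF p] by (auto simp: abs_mult)
    next
      case False
      have "0 \<le> \<bar>k\<bar> * p" "0 \<le> s p" "s p < p" using pos[OF p] s p by auto
      then have "\<bar>s p\<bar> \<le> p + \<bar>k\<bar> * p" by linarith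
      then show ?thesis using False by simp
    qed
    then have "real_of_int \<bar>?s p\<bar> \<le> real_of_int (p + \<bar>k\<bar> * p)" by (rule of_int_le_iff[THEN iffD2])
    also have "\<dots> = real_of_int p * (1 + \<bar>real_of_int k\<bar>)" by (simp add: algebra_simps)
    also have "\<dots> \<le> real_of_int p * (1 + real (card P) + ?Y)"
      using k pos[OF p] by (intro mult_left_mono) auto
    finally show "\<bar>real_of_int (?s p)\<bar> \<le> real_of_int p * (1 + real (card P) + ?Y)" by simp
  next
    have "(\<Sum>p\<in>P. real_of_int (?s p) / real_of_int p) =
        (\<Sum>p\<in>P. real_of_int (s p) / real_of_int p + (if p = q then real_of_int k else 0))"
      using pos by (intro sum.cong) (auto simp: add_divide_distrib)
    also have "\<dots> = ?Y" using q assms(1) sum by (simp add: sum.distrib)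
    finally show "(\<Sum>p\<in>P. real_of_int (?s p) / real_of_int p) = ?Y" .
  qed
qed

text \<open>Dividing numerators by valuations may leave the integers; scaling by a common multiple
  \<open>V\<close> of the valuations avoids this and multiplies the value by
  \<open>V\<close>.\<close>

lemma log_deriv_of_partial_fractions:
  assumes "\<And>p. p \<in> prime_factors n \<Longrightarrow> t p = (V div int (multiplicity p n)) * s p"
    and "\<And>p. p \<in> prime_factors n \<Longrightarrow> int (multiplicity p n) dvd V"
    and "(\<Sum>p\<in>prime_factors n. real_of_int (s p) / real_of_int p) = Y"
  shows "log_deriv t n = real_of_int V * Y"
proof -
  have "log_deriv t n = (\<Sum>p\<in>prime_factors n. real_of_int V * (real_of_int (s p) / real_of_int p))"
    unfolding log_deriv_def
  proof (intro sum.cong refl)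
    fix p assume p: "p \<in> prime_factors n"
    have "int (multiplicity p n) * (V div int (multiplicity p n)) = V"
      using assms(2)[OF p] by (rule dvd_mult_div_cancel)
    then have "real_of_int V = real (multiplicity p n) * real_of_int (V div int (multiplicity p n))"
      by (metis of_int_mult of_int_of_nat_eq)
    then show "real (multiplicity p n) * real_of_int (t p) / real_of_int p =
        real_of_int V * (real_of_int (s p) / real_of_int p)"
      by (simp add: assms(1)[OF p])
  qed
  also have "\<dots> = real_of_int V * Y"
    unfolding assms(3)[symmetric] by (rule sum_distrib_left[symmetric])
  finally show ?thesis .
qed

text \<open>The value is asserted for every \<open>u\<close> agreeing with \<open>t\<close> on the
  prime factors of \<open>n\<close>, so that the functions found for \<open>a\<close>,
  \<open>b\<close>, \<open>c\<close> can be glued along disjoint sets of primes.\<close>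

lemma partial_fractions_prime_factors:
  fixes n X V :: int
  assumes n: "n > 0" "real_of_int n \<le> c" and X: "X \<ge> 0" "n = 1 \<Longrightarrow> X = 0"
    and le: "real_of_int X / real_of_int (rad n) \<le> B"
    and V: "V > 0" "\<And>p. p \<in> prime_factors n \<Longrightarrow> int (multiplicity p n) dvd V"
    and T: "\<And>p. p \<in> prime_factors n \<Longrightarrow> real_of_int p \<le> T" "T \<ge> 0"
  shows "\<exists>t. (\<forall>p\<in>prime_factors n.
        real_of_int \<bar>t p\<bar> \<le> real_of_int V * T * (1 + log 2 c + B)) \<and>
      (\<forall>u. (\<forall>p\<in>prime_factors n. u p = t p) \<longrightarrow>
        log_deriv u n = real_of_int V * (real_of_int X / real_of_int (rad n)))"
proof -
  let ?Y = "real_of_int X / real_of_int (rad n)"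
  have X0: "X = 0" if "prime_factors n = {}"
  proof (rule X(2), rule ccontr)
    assume "n \<noteq> 1"
    then obtain p where "prime p" "p dvd n" using n prime_divisor_exists[of n] by auto
    then have "p \<in> prime_factors n" using n by (simp add: in_prime_factors_iff)
    then show False using that by simp
  qed
  have "\<exists>s. (\<forall>p\<in>prime_factors n.
      \<bar>real_of_int (s p)\<bar> \<le> real_of_int p * (1 + real (card (prime_factors n)) + ?Y)) \<and>
    (\<Sum>p\<in>prime_factors n. real_of_int (s p) / real_of_int p) = ?Y"
    unfolding rad_def
    by (rule partial_fractions_bounded) (use X(1) X0 in \<open>auto simp: in_prime_factors_iff\<close>)
  then obtain s where s: "\<forall>p\<in>prime_factors n.
      \<bar>real_of_int (s p)\<bar> \<le> real_of_int p * (1 + real (card (prime_factors n)) + ?Y)"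
    "(\<Sum>p\<in>prime_factors n. real_of_int (s p) / real_of_int p) = ?Y" by blast
  define t where "t = (\<lambda>p. (V div int (multiplicity p n)) * s p)"
  show ?thesis
  proof (intro exI[of _ t] conjI ballI allI impI)
    fix p assume p: "p \<in> prime_factors n"
    have "p > 0" using p by (auto simp: in_prime_factors_iff dest: prime_gt_0_int)
    have Y: "?Y \<ge> 0" using X(1) by (intro divide_nonneg_pos) simp_all
    have card: "real (card (prime_factors n)) \<le> log 2 c"
      using n by (intro card_prime_factors_le_log) auto
    have "0 \<le> V div int (multiplicity p n)" "V div int (multiplicity p n) \<le> V"
      using V(1) zdiv_mono2[of V 1 "int (multiplicity p n)"] p
      by (auto simp: prime_factors_multiplicity pos_imp_zdiv_nonneg_iff)
    then have "\<bar>t p\<bar> \<le> V * \<bar>s p\<bar>"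
      by (simp add: t_def abs_mult mult_right_mono)
    then have "real_of_int \<bar>t p\<bar> \<le> real_of_int (V * \<bar>s p\<bar>)" by (rule of_int_le_iff[THEN iffD2])
    also have "\<dots> = real_of_int V * \<bar>real_of_int (s p)\<bar>" by simp
    also have "\<dots> \<le> real_of_int V * (real_of_int p * (1 + real (card (prime_factors n)) + ?Y))"
      using bspec[OF s(1) p] V(1) by (intro mult_left_mono) auto
    also have "\<dots> \<le> real_of_int V * (T * (1 + log 2 c + B))"
      using T(1)[OF p] T(2) V(1) card Y le \<open>p > 0\<close>
      by (intro mult_left_mono mult_mono) auto
    finally show "real_of_int \<bar>t p\<bar> \<le> real_of_int V * T * (1 + log 2 c + B)"
      by (simp add: mult.assoc)
  next
    fix u assume "\<forall>p\<in>prime_factors n. u p = t p"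
    then show "log_deriv u n = real_of_int V * ?Y"
      using V(2) s(2) by (intro log_deriv_of_partial_fractions[where s = s]) (auto simp: t_def)
  qed
qed

text \<open>
  With \<open>a = rad a * a'\<close> etc., \<open>Xa\<close> solves \<open>rad b * Xa = - c' (mod rad a)\<close>. It then also solves
  \<open>rad c * Xa = - b' (mod rad a)\<close>, because \<open>b = c (mod a)\<close>, and this makes \<open>Xb\<close> and \<open>Xc\<close> integral.
\<close>
lemma rad_solution:
  fixes a b c :: int
  assumes abc: "abc_triple a b c"
  obtains Xa Xb Xc where "0 \<le> Xa" "Xa < rad a" "0 \<le> Xb" "0 \<le> Xc"
    "real_of_int Xb / real_of_int (rad b) =
       real_of_int Xa / real_of_int (rad a) + real_of_int c / real_of_int (rad (a * b * c))"
    "real_of_int Xc / real_of_int (rad c) =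
       real_of_int Xa / real_of_int (rad a) + real_of_int b / real_of_int (rad (a * b * c))"
proof -
  note * = abc_tripleD[OF abc]
  obtain a' b' c' where abc': "a = rad a * a'" "b = rad b * b'" "c = rad c * c'"
    using rad_dvd * by (metis dvdE less_irrefl)
  have pos: "a' > 0" "b' > 0" "c' > 0"
    using abc' * by (metis rad_pos zero_less_mult_pos)+
  have cop: "coprime (rad b) (rad a)"
    using coprime_rad[of a b] * by (simp add: coprime_commute)
  then obtain i j where ij: "i * rad b + j * rad a = 1"
    using bezout_int[of "rad b" "rad a"] by (auto simp: coprime_iff_gcd_eq_1)
  \<comment> \<open>Reduction modulo \<open>rad a\<close> keeps \<open>Xa / rad a\<close> below 1,
    which later bounds all three values by \<open>1 + c / rad (a * b * c)\<close>.\<close>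
  define Xa where "Xa = (- c' * i) mod rad a"
  have Xa: "0 \<le> Xa" "Xa < rad a" by (simp_all add: Xa_def)
  have "rad a dvd - c' * i - Xa" by (simp add: Xa_def)
  then obtain h where h: "- c' * i = Xa + rad a * h" by (metis dvdE add_diff_cancel_left' diff_add_cancel add.commute)
  have "c' + Xa * rad b = c' + (- c' * i - rad a * h) * rad b" using h by simp
  also have "\<dots> = c' * (1 - i * rad b) - rad a * (h * rad b)" by (simp add: algebra_simps)
  also have "1 - i * rad b = j * rad a" using ij by simp
  finally have "rad a dvd c' + Xa * rad b" by simp
  then obtain Xb where Xb: "c' + Xa * rad b = rad a * Xb" by blast
  have "rad b * (b' + Xa * rad c) = rad b * b' + rad c * (Xa * rad b)" by (simp add: algebra_simps)
  also have "Xa * rad b = rad a * Xb - c'" using Xb by simp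
  also have "rad b * b' + rad c * (rad a * Xb - c') = (b - c) + rad a * (rad c * Xb)"
    using abc'(2,3) by (simp add: algebra_simps)
  also have "b - c = - (rad a * a')" using abc'(1) *(4) by simp
  finally have "rad a dvd rad b * (b' + Xa * rad c)" by simp
  then have "rad a dvd b' + Xa * rad c"
    using cop by (simp add: coprime_commute coprime_dvd_mult_right_iff)
  then obtain Xc where Xc: "b' + Xa * rad c = rad a * Xc" by blast
  have nonneg: "0 \<le> Xb" "0 \<le> Xc"
  proof -
    have "0 < rad a * Xb" "0 < rad a * Xc"
      using Xb Xc pos Xa by (metis add_pos_nonneg less_imp_le mult_nonneg_nonneg rad_pos)+
    then show "0 \<le> Xb" "0 \<le> Xc"
      by (metis less_imp_le rad_pos zero_less_mult_pos)+
  qed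
  have rad_nz: "rad n \<noteq> 0" for n using rad_pos[of n] by linarith
  have rp: "real_of_int (rad a) > 0" "real_of_int (rad b) > 0" "real_of_int (rad c) > 0"
    by simp_all
  have Xb': "real_of_int c' + real_of_int Xa * real_of_int (rad b) = real_of_int (rad a) * real_of_int Xb"
    using arg_cong[OF Xb, of real_of_int] by simp
  have Xc': "real_of_int b' + real_of_int Xa * real_of_int (rad c) = real_of_int (rad a) * real_of_int Xc"
    using arg_cong[OF Xc, of real_of_int] by simp
  have cr: "real_of_int c / real_of_int (rad (a * b * c)) = real_of_int c' / (real_of_int (rad a) * real_of_int (rad b))"
    unfolding rad_abc[OF abc] by (subst abc'(3)) (simp add: rad_nz)
  have br: "real_of_int b / real_of_int (rad (a * b * c)) = real_of_int b' / (real_of_int (rad a) * real_of_int (rad c))"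
    unfolding rad_abc[OF abc] by (subst abc'(2)) (simp add: rad_nz)
  have quot: "x / s = y / r + e / (r * s)"
    if "e + y * s = r * x" "r > 0" "s > 0" for x y e r s :: real
  proof -
    have "x / s = (r * x) / (r * s)" using that(2) by simp
    also have "\<dots> = y / r + e / (r * s)"
      unfolding that(1)[symmetric] using that(2,3) by (simp add: add_divide_distrib)
    finally show ?thesis .
  qed
  show ?thesis
    by (rule that[OF Xa nonneg]; unfold cr br; rule quot[OF _ rp(1)]; fact)
qed

text \<open>Realises the values of \<open>rad_solution\<close>, scaled by the product of all
  valuations. The value at \<open>b\<close> is positive, whereas \<open>log_deriv t 1 = 0\<close>;
  hence the hypothesis \<open>b > 1\<close>.\<close>

lemma small_solution_small_primes:
  fixes a b c :: int
  assumes abc: "abc_triple a b c" and b: "b > 1"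
    and T: "\<And>p. prime p \<Longrightarrow> p dvd a * b * c \<Longrightarrow> real_of_int p \<le> T" "T \<ge> 0"
  defines "v \<equiv> \<lambda>n::int. \<Prod>p\<in>prime_factors n. int (multiplicity p n)"
  shows "small_solution (real_of_int (v a * v b * v c) * T *
    (2 + log 2 (real_of_int c) + real_of_int c / real_of_int (rad (a * b * c)))) a b (- c)"
proof -
  note * = abc_tripleD[OF abc]
  define V where "V = v a * v b * v c"
  define \<sigma> where "\<sigma> = real_of_int c / real_of_int (rad (a * b * c))"
  have \<sigma>: "\<sigma> > 0" using * by (simp add: \<sigma>_def)
  have v_pos: "v n > 0" for n
    unfolding v_def by (intro prod_pos) (auto simp: prime_factors_multiplicity)
  then have V: "V > 0" by (simp add: V_def)
  have dvd_v: "int (multiplicity p n) dvd v n" if "p \<in> prime_factors n" for p n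
    unfolding v_def using that by (intro dvd_prodI) auto
  have dvdV: "int (multiplicity p n) dvd V" if "p \<in> prime_factors n" "n \<in> {a, b, c}" for p n
    using dvd_v[OF that(1)] that(2) by (auto simp: V_def)
  obtain Xa Xb Xc where X: "0 \<le> Xa" "Xa < rad a" "0 \<le> Xb" "0 \<le> Xc"
    and Yb: "real_of_int Xb / real_of_int (rad b) = real_of_int Xa / real_of_int (rad a) + \<sigma>"
    and Yc: "real_of_int Xc / real_of_int (rad c) =
       real_of_int Xa / real_of_int (rad a) + real_of_int b / real_of_int (rad (a * b * c))"
    unfolding \<sigma>_def using rad_solution[OF abc] by blast
  define Y where "Y = real_of_int Xa / real_of_int (rad a)"
  have Ya_le: "Y \<le> 1" using X by (simp add: Y_def)
  have b_le: "real_of_int b / real_of_int (rad (a * b * c)) \<le> \<sigma>"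
    unfolding \<sigma>_def using * by (intro divide_right_mono) (auto simp: less_imp_le)
  \<comment> \<open>The part \<open>1 + log 2 c\<close> accounts for the reduced fractions and the
    number of primes, \<open>1 + \<sigma>\<close> for the prescribed values.\<close>
  let ?H = "real_of_int V * T * (1 + log 2 (real_of_int c) + (1 + \<sigma>))"
  have T': "real_of_int p \<le> T" if "p \<in> prime_factors n" "n \<in> {a, b, c}" for p n
    using that by (intro T(1)) (auto simp: in_prime_factors_iff)
  \<comment> \<open>For \<open>a = 1\<close> the radical is 1, so the reduced residue is 0, as
    \<open>log_deriv t 1 = 0\<close> demands.\<close>
  have Xa1: "Xa = 0" if "a = 1" using X that by (simp add: rad_def)
  have sol: "\<exists>t. (\<forall>p\<in>prime_factors n. real_of_int \<bar>t p\<bar> \<le> ?H) \<and>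
      (\<forall>u. (\<forall>p\<in>prime_factors n. u p = t p) \<longrightarrow>
        log_deriv u n = real_of_int V * (real_of_int X / real_of_int (rad n)))"
    if n: "n \<in> {a, b, c}" and X: "X \<ge> 0" "n = 1 \<Longrightarrow> X = 0"
      and le: "real_of_int X / real_of_int (rad n) \<le> 1 + \<sigma>" for n X
  proof -
    have "n > 0" "real_of_int n \<le> real_of_int c" using n * by auto
    then show ?thesis
      by (rule partial_fractions_prime_factors[OF _ _ X le V dvdV[OF _ n] T'[OF _ n] T(2)])
  qed
  have Yc_le: "real_of_int Xc / real_of_int (rad c) \<le> 1 + \<sigma>"
    using Yc Ya_le b_le unfolding Y_def by linarith
  obtain ta where ta: "\<forall>p\<in>prime_factors a. real_of_int \<bar>ta p\<bar> \<le> ?H"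
      "\<And>u. \<forall>p\<in>prime_factors a. u p = ta p \<Longrightarrow> log_deriv u a = real_of_int V * Y"
    using sol[of a Xa] X Xa1 Ya_le \<sigma> unfolding Y_def by auto
  obtain tb where tb: "\<forall>p\<in>prime_factors b. real_of_int \<bar>tb p\<bar> \<le> ?H"
      "\<And>u. \<forall>p\<in>prime_factors b. u p = tb p \<Longrightarrow>
        log_deriv u b = real_of_int V * (real_of_int Xb / real_of_int (rad b))"
    using sol[of b Xb] X b Yb Ya_le unfolding Y_def by auto
  obtain tc where tc: "\<forall>p\<in>prime_factors c. real_of_int \<bar>tc p\<bar> \<le> ?H"
      "\<And>u. \<forall>p\<in>prime_factors c. u p = tc p \<Longrightarrow>
        log_deriv u c = real_of_int V * (real_of_int Xc / real_of_int (rad c))"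
    using sol[OF _ X(4) _ Yc_le] b *(1,4) by auto
  note disj = *(5-7)[THEN prime_factors_Int_coprime]
  define t where "t = (\<lambda>p. if p \<in> prime_factors a then ta p else if p \<in> prime_factors b then tb p
    else if p \<in> prime_factors c then tc p else 0)"
  have La: "log_deriv t a = real_of_int V * Y"
    by (rule ta(2)) (simp add: t_def)
  have Lb: "log_deriv t b = real_of_int V * (Y + \<sigma>)"
    unfolding Y_def Yb[symmetric] by (rule tb(2)) (use disj in \<open>auto simp: t_def\<close>)
  have Lc: "log_deriv t c = real_of_int V * (Y + real_of_int b / real_of_int (rad (a * b * c)))"
    unfolding Y_def Yc[symmetric] by (rule tc(2)) (use disj in \<open>auto simp: t_def\<close>)
  have H: "?H \<ge> 0" using V T(2) \<sigma> * by simp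
  have "real_of_int \<bar>t p\<bar> \<le> ?H" for p
    using ta(1) tb(1) tc(1) H by (auto simp: t_def)
  moreover have "p dvd a * b * (- c)" if "t p \<noteq> 0" for p
    using that by (auto simp: t_def in_prime_factors_iff split: if_splits)
  moreover have "real_of_int a * log_deriv t a + real_of_int b * log_deriv t b +
      real_of_int (- c) * log_deriv t (- c) = 0"
  proof -
    \<comment> \<open>The terms \<open>b * \<sigma>\<close> and
      \<open>c * (b / rad (a * b * c))\<close> cancel.\<close>
    have "real_of_int a * log_deriv t a + real_of_int b * log_deriv t b +
        real_of_int (- c) * log_deriv t (- c) =
        real_of_int V * Y * (real_of_int a + real_of_int b - real_of_int c)"
      by (simp add: La Lb Lc \<sigma>_def algebra_simps)
    then show ?thesis by (simp add: *(4))
  qed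
  moreover have "log_deriv t a \<noteq> log_deriv t b" using V \<sigma> by (simp add: La Lb)
  ultimately have "small_solution ?H a b (- c)"
    unfolding small_solution_def by blast
  then show ?thesis by (simp add: V_def \<sigma>_def add.assoc)
qed

section \<open>The abc conjecture yields small derivatives\<close>

text \<open>These are the configurations that the large-prime construction cannot treat: the prime
  is itself an entry and another entry is 1.\<close>

lemma one_N_prime_formI:
  assumes "abc_triple a b c" "prime q"
    and "{a, b} = {1, q} \<or> (1 \<in> {a, b} \<and> c = q)"
  shows "one_N_prime_form a b c"
proof -
  note * = abc_tripleD[OF assms(1)]
  from assms(3) consider "a = 1" "b = q" | "a = q" "b = 1" | "a = 1" "c = q" | "b = 1" "c = q"
    by (auto simp: doubleton_eq_iff)
  then have "\<exists>N > 0. {#a, b, c#} = {#1, N, q#}"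
  proof cases
    case 1 then show ?thesis using * by (intro exI[of _ c]) (simp add: add_mset_commute)
  next
    case 2 then show ?thesis using * by (intro exI[of _ c]) (simp add: add_mset_commute)
  next
    case 3 then show ?thesis using *(2) by (intro exI[of _ b]) (simp add: add_mset_commute)
  next
    case 4 then show ?thesis using *(1) by (intro exI[of _ a]) (simp add: add_mset_commute)
  qed
  then show ?thesis using assms(2) unfolding one_N_prime_form_def by blast
qed

text \<open>The notion of solution is symmetric in \<open>a\<close>, \<open>b\<close>,
  \<open>- c\<close>, so the entry divisible by \<open>p\<close> can be put first. The excluded form
  and \<open>c > 2\<close> supply the conditions on units.\<close>

lemma small_solution_abc_large_prime:
  fixes a b c p H :: int
  assumes abc: "abc_triple a b c" and form: "\<not> one_N_prime_form a b c" and c: "c > 2"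
    and H: "H \<ge> 1" "9 * real_of_int c * log 2 (real_of_int c) \<le> (real_of_int H)\<^sup>2"
    and p: "prime p" "p dvd a * b * c" "H < p" "real_of_int p ^ 2 > real_of_int c"
  shows "small_solution (real_of_int H) a b (- c)"
proof -
  note * = abc_tripleD[OF abc]
  note form' = one_N_prime_formI[OF abc p(1)]
  have nz: "a \<noteq> 0" "b \<noteq> 0" "- c \<noteq> 0" using * by auto
  have cop: "coprime a b" "coprime a (- c)" "coprime b (- c)"
      "coprime b a" "coprime (- c) a" "coprime (- c) b"
    using *(5-7) by (simp_all add: coprime_commute)
  have le: "real_of_int \<bar>a\<bar> \<le> real_of_int c" "real_of_int \<bar>b\<bar> \<le> real_of_int c"
      "real_of_int \<bar>- c\<bar> \<le> real_of_int c" using * by auto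
  have unit_a: "is_unit a \<longleftrightarrow> a = 1" and unit_b: "is_unit b \<longleftrightarrow> b = 1" and unit_c: "\<not> is_unit (- c)"
    using * c by auto
  from p(1,2) consider "p dvd a" | "p dvd b" | "p dvd - c"
    by (auto simp: prime_dvd_mult_iff)
  then show ?thesis
  proof cases
    case 1
    show ?thesis
      by (rule small_solution_large_prime[OF nz cop(1,2,3) le H p(1) 1 p(3,4)])
         (use unit_b unit_c form form' * in auto)
  next
    case 2
    have "small_solution (real_of_int H) b a (- c)"
      by (rule small_solution_large_prime[OF nz(2,1,3) cop(4,3,2) le(2,1,3) H p(1) 2 p(3,4)])
         (use unit_a unit_c form form' * in auto)
    then show ?thesis by (subst small_solution_swap12)
  next
    case 3
    have "small_solution (real_of_int H) (- c) a b"
      by (rule small_solution_large_prime[OF nz(3,1,2) cop(5,6,1) le(3,1,2) H p(1) 3 p(3,4)])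
         (use unit_a unit_b form form' * c in auto)
    then show ?thesis
      using small_solution_swap12 small_solution_swap23 by metis
  qed
qed

text \<open>Since \<open>c > 2\<close>, one of \<open>a\<close>, \<open>b\<close> exceeds 1, and
  exchanging them covers the case \<open>b = 1\<close>.\<close>

lemma small_solution_abc_small_primes:
  fixes a b c :: int
  assumes abc: "abc_triple a b c" and c: "c > 2"
    and T: "\<And>p. prime p \<Longrightarrow> p dvd a * b * c \<Longrightarrow> real_of_int p \<le> T" "T \<ge> 0"
  defines "v \<equiv> \<lambda>n::int. \<Prod>p\<in>prime_factors n. int (multiplicity p n)"
  shows "small_solution (real_of_int (v a * v b * v c) * T *
    (2 + log 2 (real_of_int c) + real_of_int c / real_of_int (rad (a * b * c)))) a b (- c)"
proof (cases "b > 1")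
  case True
  then show ?thesis unfolding v_def using small_solution_small_primes[OF abc _ T] by blast
next
  case False
  note * = abc_tripleD[OF abc]
  have "a > 1" using False c * by linarith
  have "Gcd {b, a, c} = 1" using abc by (simp only: abc_triple_def insert_commute)
  then have "abc_triple b a c" using abc by (simp add: abc_triple_def add.commute)
  from small_solution_small_primes[OF this \<open>a > 1\<close>, of T] T
  show ?thesis
    unfolding v_def by (subst small_solution_swap12) (simp add: mult.commute mult.left_commute)
qed

lemma ABC_imp_small_derivatives:
  assumes ABC_conjecture
  shows small_derivatives_conjecture
proof -
  \<comment> \<open>The choice \<open>1 / 30\<close> for \<open>\<epsilon>\<close> fits
    \<open>rad (a * b * c) \<le> c ^ 3\<close>: the excess power of the radical is at most
    \<open>c powr (1/10)\<close>.\<close>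
  obtain \<kappa> :: real where \<kappa>: "\<kappa> > 0" "\<And>a b c. abc_triple a b c \<Longrightarrow>
      real_of_int c < \<kappa> * real_of_int (rad (a * b * c)) powr (1 + 1 / 30)"
    using assms unfolding ABC_conjecture_def
    by (metis divide_pos_pos zero_less_numeral zero_less_one)
  define v where "v = (\<lambda>n::int. \<Prod>p\<in>prime_factors n. int (multiplicity p n))"
  \<comment> \<open>The exponent 30 likewise bounds the product of all valuations by
    \<open>K * c powr (1/10)\<close>.\<close>
  obtain C :: int where C: "C \<ge> 1" "\<And>n. n \<noteq> 0 \<Longrightarrow> v n ^ 30 \<le> C * \<bar>n\<bar>"
    using prod_multiplicity_power_le[of 30] unfolding v_def by auto
  define K where "K = (real_of_int C ^ 3) powr (1 / 30)"
  have K: "K > 0" using C(1) by (simp add: K_def)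
  \<comment> \<open>The exponents add up to \<open>1/10 + 2/3 + 1/10 = 13/15 < 9/10\<close>, which
    leaves room for the logarithm.\<close>
  have "eventually (\<lambda>x::real. K * x powr (1/10) * x powr (2/3) * (2 + log 2 x + \<kappa> * x powr (1/10))
      < x powr (9/10)) at_top"
    using K \<kappa>(1) by real_asymp
  \<comment> \<open>The summand 1 pays for rounding the height in Siegel's lemma up to an
    integer.\<close>
  moreover have "eventually (\<lambda>x::real. sqrt (9 * x * log 2 x) + 1 < x powr (2/3)) at_top"
    by real_asymp
  ultimately have "eventually (\<lambda>x::real. K * x powr (1/10) * x powr (2/3) * (2 + log 2 x + \<kappa> * x powr (1/10))
      < x powr (9/10) \<and> sqrt (9 * x * log 2 x) + 1 < x powr (2/3) \<and> x > 2) at_top"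
    using eventually_gt_at_top[of "2::real"] by eventually_elim simp
  then obtain x0 where x0: "\<And>x. x \<ge> x0 \<Longrightarrow>
      K * x powr (1/10) * x powr (2/3) * (2 + log 2 x + \<kappa> * x powr (1/10)) < x powr (9/10) \<and>
      sqrt (9 * x * log 2 x) + 1 < x powr (2/3) \<and> x > 2"
    unfolding eventually_at_top_linorder by blast
  have main: "\<exists>\<psi>\<in>derivations a b. psi_independent \<psi> a b \<and>
      psi_norm \<psi> < ereal (real_of_int c powr (9/10))"
    if abc: "abc_triple a b c" and form: "\<not> one_N_prime_form a b c" and large: "real_of_int c \<ge> x0"
    for a b c
  proof -
    note * = abc_tripleD[OF abc]
    define x where "x = real_of_int c"
    have x: "K * x powr (1/10) * x powr (2/3) * (2 + log 2 x + \<kappa> * x powr (1/10)) < x powr (9/10)"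
        "sqrt (9 * x * log 2 x) + 1 < x powr (2/3)" "x > 2"
      using x0[OF large] by (auto simp: x_def)
    have c2: "c > 2" using x(3) by (simp add: x_def)
    have abc_le: "real_of_int (a * b * c) \<le> x ^ 3"
    proof -
      have "a * b * c \<le> c * c * c" using * by (intro mult_mono) auto
      then have "real_of_int (a * b * c) \<le> real_of_int (c * c * c)" by (rule of_int_le_iff[THEN iffD2])
      then show ?thesis by (simp add: x_def power3_eq_cube)
    qed
    have "\<exists>H. small_solution H a b (- c) \<and> H < x powr (9/10)"
    proof (cases "\<exists>p. prime p \<and> p dvd a * b * c \<and> real_of_int p > x powr (2/3)")
      case True
      then obtain p where p: "prime p" "p dvd a * b * c" "real_of_int p > x powr (2/3)" by blast
      define H where "H = \<lceil>sqrt (9 * x * log 2 x)\<rceil>"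
      have pos: "9 * x * log 2 x > 0" using x(3) by simp
      have H1: "H \<ge> 1" using pos by (simp add: H_def)
      have H_ge: "sqrt (9 * x * log 2 x) \<le> real_of_int H" by (simp add: H_def)
      have H_lt: "real_of_int H < x powr (2/3)" using x(2) unfolding H_def by linarith
      have "sqrt (9 * x * log 2 x) ^ 2 \<le> real_of_int H ^ 2"
        using H_ge pos by (intro power_mono) auto
      then have H2: "9 * real_of_int c * log 2 (real_of_int c) \<le> (real_of_int H)\<^sup>2"
        using pos by (simp add: x_def)
      have "x = x powr 1" using x(3) by simp
      also have "\<dots> \<le> x powr (2/3 + 2/3)" using x(3) by (intro powr_mono) auto
      also have "\<dots> = (x powr (2/3)) ^ 2" by (simp only: powr_add power2_eq_square)
      also have "\<dots> < real_of_int p ^ 2" using p(3) by (intro power_strict_mono) auto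
      finally have p2: "real_of_int p ^ 2 > real_of_int c" by (simp add: x_def)
      have "H < p" using H_lt p(3) by linarith
      then have "small_solution (real_of_int H) a b (- c)"
        by (rule small_solution_abc_large_prime[OF abc form c2 H1 H2 p(1,2) _ p2])
      moreover have "x powr (2/3) \<le> x powr (9/10)" using x(3) by (intro powr_mono) auto
      ultimately show ?thesis using H_lt by (intro exI[of _ "real_of_int H"]) auto
    next
      case False
      define \<rho> where "\<rho> = real_of_int (rad (a * b * c))"
      have \<rho>: "\<rho> > 0" by (simp add: \<rho>_def)
      have "rad (a * b * c) \<le> a * b * c"
        using * by (intro zdvd_imp_le rad_dvd) auto
      then have \<rho>_le: "\<rho> \<le> x ^ 3" using abc_le unfolding \<rho>_def by linarith
      have "x < \<kappa> * (\<rho> * \<rho> powr (1 / 30))"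
      proof -
        have "\<rho> powr (1 + 1 / 30) = \<rho> * \<rho> powr (1 / 30)"
          by (subst powr_add) (use \<rho> in simp)
        then show ?thesis using \<kappa>(2)[OF abc] by (simp only: x_def \<rho>_def)
      qed
      then have "x / \<rho> < \<kappa> * \<rho> powr (1 / 30)"
        using \<rho> by (simp add: divide_less_eq mult_ac)
      also have "\<dots> \<le> \<kappa> * (x ^ 3) powr (1 / 30)"
        using \<kappa>(1) \<rho> \<rho>_le by (intro mult_left_mono powr_mono2) auto
      also have "(x ^ 3) powr (1 / 30) = x powr (1 / 10)"
        using x(3) by (simp add: powr_powr flip: powr_numeral)
      finally have \<sigma>_le: "x / \<rho> \<le> \<kappa> * x powr (1 / 10)" by simp
      define V where "V = v a * v b * v c"
      have v_pos: "v n > 0" for n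
        unfolding v_def by (intro prod_pos) (auto simp: prime_factors_multiplicity)
      have V_pos: "V > 0" by (simp add: V_def v_pos)
      have "V ^ 30 = v a ^ 30 * v b ^ 30 * v c ^ 30" by (simp add: V_def power_mult_distrib)
      also have "\<dots> \<le> (C * \<bar>a\<bar>) * (C * \<bar>b\<bar>) * (C * \<bar>c\<bar>)"
        using C(1) v_pos[THEN less_imp_le] *(1-3)
        by (intro mult_mono C(2) mult_nonneg_nonneg zero_le_power) simp_all
      also have "\<dots> = C ^ 3 * (a * b * c)" using * by (simp add: power3_eq_cube)
      finally have "real_of_int (V ^ 30) \<le> real_of_int (C ^ 3 * (a * b * c))" by (rule of_int_le_iff[THEN iffD2])
      also have "\<dots> = real_of_int C ^ 3 * real_of_int (a * b * c)" by simp
      also have "\<dots> \<le> real_of_int C ^ 3 * x ^ 3"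
        using abc_le C(1) by (intro mult_left_mono) auto
      finally have "real_of_int V ^ 30 \<le> real_of_int C ^ 3 * x ^ 3" by simp
      then have "(real_of_int V ^ 30) powr (1 / 30) \<le> (real_of_int C ^ 3 * x ^ 3) powr (1 / 30)"
        using V_pos by (intro powr_mono2) auto
      also have "(real_of_int V ^ 30) powr (1 / 30) = real_of_int V"
        using V_pos by (simp add: powr_powr flip: powr_numeral)
      also have "(real_of_int C ^ 3 * x ^ 3) powr (1 / 30) = K * (x ^ 3) powr (1 / 30)"
        using C(1) x(3) by (simp add: powr_mult K_def)
      also have "(x ^ 3) powr (1 / 30) = x powr (1 / 10)"
        using x(3) by (simp add: powr_powr flip: powr_numeral)
      finally have V_le: "real_of_int V \<le> K * x powr (1 / 10)" .
      let ?H = "real_of_int V * x powr (2/3) * (2 + log 2 x + x / \<rho>)"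
      have "small_solution ?H a b (- c)"
        unfolding V_def v_def x_def \<rho>_def
        by (rule small_solution_abc_small_primes[OF abc c2]) (use False in \<open>auto simp: x_def not_less\<close>)
      moreover have "?H \<le> K * x powr (1/10) * x powr (2/3) * (2 + log 2 x + \<kappa> * x powr (1/10))"
        using V_le \<sigma>_le K x(3) \<rho> by (intro mult_mono) (auto intro!: add_nonneg_nonneg)
      ultimately show ?thesis using x(1) by (intro exI[of _ ?H]) auto
    qed
    then obtain H where H: "small_solution H a b (- c)" "H < x powr (9/10)" by blast
    obtain \<psi> where "\<psi> \<in> derivations a b" "psi_independent \<psi> a b" "psi_norm \<psi> \<le> ereal H"
      using derivation_of_small_solution[OF abc H(1)] by blast
    moreover have "ereal H < ereal (real_of_int c powr (9/10))" using H(2) by (simp add: x_def)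
    ultimately show ?thesis by (meson order_le_less_trans)
  qed
  \<comment> \<open>Every exceptional triple has \<open>c < x0\<close>, and \<open>a\<close>,
    \<open>b\<close> are smaller than \<open>c\<close>, so all of them lie in a finite box.\<close>
  have "{(a, b, c). abc_triple a b c \<and> \<not> one_N_prime_form a b c \<and>
      \<not> (\<exists>\<psi>\<in>derivations a b. psi_independent \<psi> a b \<and>
            psi_norm \<psi> < ereal (real_of_int c powr (9/10)))}
    \<subseteq> {0..\<lceil>x0\<rceil>} \<times> {0..\<lceil>x0\<rceil>} \<times> {0..\<lceil>x0\<rceil>}"
  proof clarify
    fix a b c
    assume abc: "abc_triple a b c" and "\<not> one_N_prime_form a b c"
      "\<not> (\<exists>\<psi>\<in>derivations a b. psi_independent \<psi> a b \<and>
            psi_norm \<psi> < ereal (real_of_int c powr (9/10)))"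
    then have "real_of_int c < x0" using main[of a b c] by (meson not_le)
    then have "c \<le> \<lceil>x0\<rceil>" by linarith
    then show "a \<in> {0..\<lceil>x0\<rceil>} \<and> (b, c) \<in> {0..\<lceil>x0\<rceil>} \<times> {0..\<lceil>x0\<rceil>}"
      using abc_tripleD(1-4)[OF abc] by simp
  qed
  then have "finite {(a, b, c). abc_triple a b c \<and> \<not> one_N_prime_form a b c \<and>
      \<not> (\<exists>\<psi>\<in>derivations a b. psi_independent \<psi> a b \<and>
            psi_norm \<psi> < ereal (real_of_int c powr (9/10)))}"
    by (rule finite_subset) simp
  then show ?thesis
    unfolding small_derivatives_conjecture_def by (intro exI[of _ "9/10"]) auto
qed

theorem corollary4p6:
  shows "(ABC_conjecture \<longrightarrow> small_derivatives_conjecture) \<and>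
         (small_derivatives_conjecture \<longrightarrow> Oesterle_conjecture)"
  using ABC_imp_small_derivatives small_derivatives_imp_Oesterle by blast

end
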